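(* Let $\mathbb{S}^1=\mathbb{R}/\mathbb{Z}$ and let $SS^1(\mathbb{S}^1)\subseteq C^1(\mathbb{S}^1)$ be the set of all $f\in C^1(\mathbb{S}^1)$ such that the dynamical system $\dot{x}=f(x)$ is $C^1$ structurally stable. Then $SS^1(\mathbb{S}^1)$ is open and dense in $C^1(\mathbb{S}^1)$ with respect to the $C^1$-topology.
   Context: The circle is $\mathbb{S}^1=\mathbb{R}/\mathbb{Z}$, i.e. the unit interval $[0,1]$ with its end points identified. $C^1(\mathbb{S}^1)$ denotes the set of $C^1$ functions (vector fields) $f:\mathbb{S}^1\to\mathbb{R}$; equivalently, $C^1$ functions $f:\mathbb{R}\to\mathbb{R}$ with $f(x+1)=f(x)$ for all $x\in\mathbb{R}$, or $C^1$ functions $f:[0,1]\to\mathbb{R}$ with $f(0)=f(1)$ and $f'(0)=f'(1)$. Each $f\in C^1(\mathbb{S}^1)$ defines a dynamical system $\dot{x}=f(x)$ on $\mathbb{S}^1$, and dynamical systems are identified with their vector fields. Topological equivalence: two dynamical systems $\dot{x}=f(x)$ and $\dot{y}=g(y)$ on $\mathbb{S}^1$ are topologically equivalent if there is a homeomorphism $h:\mathbb{S}^1\to\mathbb{S}^1$ that maps the orbits of the first system, oriented by increasing time, onto the orbits of the second system, oriented by increasing time (preserving these time orientations). $C^1$ norm and topology: for $f\in C^1(\mathbb{S}^1)$, $\|f\|_1:=\sup\{|f(x)|:x\in\mathbb{S}^1\}+\sup\{|f'(x)|:x\in\mathbb{S}^1\}$. The $C^1$-topology on $C^1(\mathbb{S}^1)$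 is the topology generated by this norm via the open balls $B^1_\epsilon(f):=\{g\in C^1(\mathbb{S}^1):\|g-f\|_1<\epsilon\}$. Structural stability: the system $\dot{x}=f(x)$ with $f\in C^1(\mathbb{S}^1)$ is $C^1$ structurally stable if for every sufficiently small $\epsilon>0$, for all $g\in B^1_\epsilon(f)$ the system $\dot{y}=g(y)$ is topologically equivalent to $\dot{x}=f(x)$. *)

theory Defs
  imports "HOL-Analysis.Analysis"
begin

section \<open>The circle\<close>

quotient_type circle = real / "\<lambda>x y::real. x - y \<in> \<int>"
  morphisms rep_circle to_circle
proof (intro equivpI reflpI sympI transpI)
  show "x - x \<in> \<int>" for x :: real
    by simp
  show "y - x \<in> \<int>" if "x - y \<in> \<int>" for x y :: real
    using that by (metis Ints_minus minus_diff_eq)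
  show "x - z \<in> \<int>" if "x - y \<in> \<int>" "y - z \<in> \<int>" for x y z :: real
    using Ints_add[OF that] by simp
qed

instantiation circle :: topological_space
begin

definition open_circle :: "circle set \<Rightarrow> bool"
  where "open_circle U \<longleftrightarrow> open (to_circle -` U)"

instance
  by standard (auto simp: open_circle_def vimage_Int vimage_Union)

end

lemma to_circle_eq_iff: "to_circle x = to_circle y \<longleftrightarrow> x - y \<in> \<int>"
  by (rule circle.abs_eq_iff)

lemma to_circle_add_1 [simp]: "to_circle (x + 1) = to_circle x"
  by (simp add: to_circle_eq_iff)

lemma surj_to_circle: "surj to_circle"
  by (metis Quotient3_abs_rep Quotient3_circle surjI)

lemma continuous_on_to_circle: "continuous_on UNIV to_circle"
  by (simp add: continuous_on_open_vimage open_circle_def)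

lemma continuous_on_circle_iff:
  "continuous_on UNIV f \<longleftrightarrow> continuous_on UNIV (f \<circ> to_circle)"
  for f :: "circle \<Rightarrow> 'a::topological_space"
  by (simp add: continuous_on_open_vimage open_circle_def vimage_comp comp_def)


section \<open>Vector fields of class \<open>C\<^sup>1\<close>\<close>

text \<open>The composition \<open>f \<circ> to_circle\<close> is the 1-periodic function on the real line
  associated with \<open>f\<close>.\<close>

definition C1_circle :: "(circle \<Rightarrow> real) set"
  where "C1_circle = {f. (f \<circ> to_circle) C1_differentiable_on UNIV}"

definition C1_norm :: "(circle \<Rightarrow> real) \<Rightarrow> real"
  where "C1_norm f = (SUP p. \<bar>f p\<bar>) + (SUP x. \<bar>deriv (f \<circ> to_circle) x\<bar>)"

definition C1_ball :: "(circle \<Rightarrow> real) \<Rightarrow> real \<Rightarrow> (circle \<Rightarrow> real) set"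
  where "C1_ball f \<epsilon> = {g \<in> C1_circle. C1_norm (g - f) < \<epsilon>}"

text \<open>The type-class topology on \<open>circle \<Rightarrow> real\<close> is that of pointwise convergence;
  hence the \<open>C\<^sup>1\<close> topology is given as an abstract topology. The balls form a base of it,
  see \<open>openin_C1_topology\<close> below.\<close>

definition C1_topology :: "(circle \<Rightarrow> real) topology"
  where "C1_topology = topology_generated_by {C1_ball f \<epsilon> | f \<epsilon>. f \<in> C1_circle \<and> \<epsilon> > 0}"


section \<open>Topological equivalence and structural stability\<close>

text \<open>A differentiable curve in the circle is the projection of a differentiable curve \<open>x\<close>
  in the real line, and the tangent spaces of the circle are identified with the real line through
  the projection. Since \<open>C\<^sup>1\<close> vector fields on the circle are complete, maximal solutions
  are defined for all times.\<close>

definition solution :: "(circle \<Rightarrow> real) \<Rightarrow> (real \<Rightarrow> circle) \<Rightarrow> bool"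
  where "solution f \<phi> \<longleftrightarrow>
    (\<exists>x. \<phi> = to_circle \<circ> x \<and>
         (\<forall>t. (x has_real_derivative f (to_circle (x t))) (at t)))"

text \<open>An oriented curve is a parametrised curve up to increasing reparametrisation of time;
  it is represented by the set of all its parametrisations. A strictly increasing surjection of the
  real line is automatically a homeomorphism. Solutions that differ by a shift
  of time yield the same oriented curve, so that every orbit of the system occurs
  exactly once among the oriented orbits.\<close>

definition oriented_curve :: "(real \<Rightarrow> circle) \<Rightarrow> (real \<Rightarrow> circle) set"
  where "oriented_curve \<phi> = {\<phi> \<circ> \<tau> | \<tau>. strict_mono \<tau> \<and> surj \<tau>}"

definition oriented_orbits :: "(circle \<Rightarrow> real) \<Rightarrow> (real \<Rightarrow> circle) set set"
  where "oriented_orbits f = {oriented_curve \<phi> | \<phi>. solution f \<phi>}"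

definition topologically_equivalent :: "(circle \<Rightarrow> real) \<Rightarrow> (circle \<Rightarrow> real) \<Rightarrow> bool"
  where "topologically_equivalent f g \<longleftrightarrow>
    (\<exists>h k. homeomorphism UNIV UNIV h k \<and>
           (\<lambda>C. (\<lambda>\<gamma>. h \<circ> \<gamma>) ` C) ` oriented_orbits f = oriented_orbits g)"

definition structurally_stable :: "(circle \<Rightarrow> real) \<Rightarrow> bool"
  where "structurally_stable f \<longleftrightarrow>
    (\<forall>\<^sub>F \<epsilon> in at_right 0. \<forall>g \<in> C1_ball f \<epsilon>. topologically_equivalent g f)"

definition SS1 :: "(circle \<Rightarrow> real) set"
  where "SS1 = {f \<in> C1_circle. structurally_stable f}"


section \<open>Basic properties of the \<open>C\<^sup>1\<close> norm\<close>

lemma C1_circle_iff: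
  "f \<in> C1_circle \<longleftrightarrow> (\<forall>x. (f \<circ> to_circle) differentiable (at x)) \<and>
     continuous_on UNIV (deriv (f \<circ> to_circle))"
proof
  assume "f \<in> C1_circle"
  then obtain D where D: "\<And>x. ((f \<circ> to_circle) has_vector_derivative D x) (at x)"
    and cont: "continuous_on UNIV D"
    by (auto simp: C1_circle_def C1_differentiable_on_def)
  have "deriv (f \<circ> to_circle) = D"
    using D by (auto intro!: ext DERIV_imp_deriv simp: has_real_derivative_iff_has_vector_derivative)
  with D cont show "(\<forall>x. (f \<circ> to_circle) differentiable (at x)) \<and>
     continuous_on UNIV (deriv (f \<circ> to_circle))"
    by (metis differentiableI_vector)
next
  assume *: "(\<forall>x. (f \<circ> to_circle) differentiable (at x)) \<and>
     continuous_on UNIV (deriv (f \<circ> to_circle))"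
  then have "((f \<circ> to_circle) has_vector_derivative deriv (f \<circ> to_circle) x) (at x)" for x
    by (metis DERIV_deriv_iff_real_differentiable has_real_derivative_iff_has_vector_derivative)
  with * show "f \<in> C1_circle"
    by (auto simp: C1_circle_def C1_differentiable_on_def)
qed

lemma C1_circle_has_derivative:
  "f \<in> C1_circle \<Longrightarrow>
    ((f \<circ> to_circle) has_real_derivative deriv (f \<circ> to_circle) x) (at x)"
  by (simp add: C1_circle_iff DERIV_deriv_iff_real_differentiable)

lemma deriv_to_circle_periodic:
  assumes "f \<in> C1_circle" "x - y \<in> \<int>"
  shows "deriv (f \<circ> to_circle) x = deriv (f \<circ> to_circle) y"
proof -
  have "to_circle (z + (x - y)) = to_circle z" for z
    using assms by (simp add: to_circle_eq_iff)
  then have "(\<lambda>z. (f \<circ> to_circle) (z + (x - y))) = f \<circ> to_circle"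
    by auto
  moreover have "((\<lambda>z. (f \<circ> to_circle) (z + (x - y))) has_real_derivative
      deriv (f \<circ> to_circle) x) (at y)"
    using C1_circle_has_derivative[OF assms(1), of x] DERIV_shift[of "f \<circ> to_circle" _ y "x - y"]
    by simp
  ultimately show ?thesis
    using DERIV_imp_deriv by metis
qed

lemma bounded_periodic:
  fixes u :: "real \<Rightarrow> real"
  assumes "continuous_on UNIV u" "\<And>x y. x - y \<in> \<int> \<Longrightarrow> u x = u y"
  shows "bdd_above (range (\<lambda>x. \<bar>u x\<bar>))"
proof -
  have "u x = u (frac x)" for x
    by (rule assms) (simp add: frac_def)
  moreover have "frac x \<in> {0..1}" for x :: real
    by (simp add: frac_lt_1 less_imp_le)
  ultimately have "range (\<lambda>x. \<bar>u x\<bar>) \<subseteq> (\<lambda>x. \<bar>u x\<bar>) ` {0..1}"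
    by (smt (verit) image_iff subsetI)
  moreover have "compact ((\<lambda>x. \<bar>u x\<bar>) ` {0..1})"
    by (intro compact_continuous_image continuous_intros continuous_on_subset[OF assms(1)]) auto
  ultimately show ?thesis
    by (meson bdd_above_mono bounded_imp_bdd_above compact_imp_bounded)
qed

lemma C1_circle_continuous: "f \<in> C1_circle \<Longrightarrow> continuous_on UNIV (f \<circ> to_circle)"
  by (meson C1_circle_iff continuous_at_imp_continuous_on differentiable_imp_continuous_within)

lemma C1_circle_bdd:
  assumes "f \<in> C1_circle"
  shows "bdd_above (range (\<lambda>p. \<bar>f p\<bar>))" "bdd_above (range (\<lambda>x. \<bar>deriv (f \<circ> to_circle) x\<bar>))"
proof -
  have "bdd_above (range (\<lambda>x. \<bar>(f \<circ> to_circle) x\<bar>))"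
    using bounded_periodic[OF C1_circle_continuous[OF assms]] by (metis comp_apply to_circle_eq_iff)
  moreover have "range (\<lambda>x. \<bar>(f \<circ> to_circle) x\<bar>) = range (\<lambda>p. \<bar>f p\<bar>)"
    using surj_to_circle by (auto simp: image_iff) (metis surjD)
  ultimately show "bdd_above (range (\<lambda>p. \<bar>f p\<bar>))"
    by simp
  show "bdd_above (range (\<lambda>x. \<bar>deriv (f \<circ> to_circle) x\<bar>))"
    using assms by (intro bounded_periodic deriv_to_circle_periodic) (auto simp: C1_circle_iff)
qed

lemma C1_circle_diff: "f \<in> C1_circle \<Longrightarrow> g \<in> C1_circle \<Longrightarrow> f - g \<in> C1_circle"
  and C1_circle_add: "f \<in> C1_circle \<Longrightarrow> g \<in> C1_circle \<Longrightarrow> (\<lambda>p. f p + g p) \<in> C1_circle"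
  unfolding C1_circle_def
  using C1_differentiable_on_diff[of "f \<circ> to_circle" UNIV "g \<circ> to_circle"]
    C1_differentiable_on_add[of "f \<circ> to_circle" UNIV "g \<circ> to_circle"]
  by (auto simp: comp_def)

lemma C1_norm_upper:
  assumes "f \<in> C1_circle"
  shows "\<bar>f p\<bar> + \<bar>deriv (f \<circ> to_circle) x\<bar> \<le> C1_norm f"
  unfolding C1_norm_def by (intro add_mono cSUP_upper C1_circle_bdd assms) auto

lemma C1_norm_nonneg: "f \<in> C1_circle \<Longrightarrow> 0 \<le> C1_norm f"
  using C1_norm_upper[of f undefined 0] by linarith

lemma C1_norm_eq_0_iff:
  assumes "f \<in> C1_circle"
  shows "C1_norm f = 0 \<longleftrightarrow> f = (\<lambda>_. 0)"
proof
  assume "C1_norm f = 0"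
  then have "\<bar>f p\<bar> \<le> 0" for p
    using C1_norm_upper[OF assms, of p 0] by linarith
  then show "f = (\<lambda>_. 0)"
    by auto
qed (simp add: C1_norm_def comp_def)

lemma C1_norm_triangle:
  assumes "f \<in> C1_circle" "g \<in> C1_circle"
  shows "C1_norm (\<lambda>p. f p + g p) \<le> C1_norm f + C1_norm g"
proof -
  have d: "deriv ((\<lambda>p. f p + g p) \<circ> to_circle) x =
      deriv (f \<circ> to_circle) x + deriv (g \<circ> to_circle) x" for x
    using DERIV_add[OF assms[THEN C1_circle_has_derivative, of x]]
    by (intro DERIV_imp_deriv) (simp add: comp_def)
  note up = cSUP_upper[OF UNIV_I]
  have "(SUP p. \<bar>f p + g p\<bar>) \<le> (SUP p. \<bar>f p\<bar>) + (SUP p. \<bar>g p\<bar>)"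
  proof (rule cSUP_least)
    fix p
    have "\<bar>f p + g p\<bar> \<le> \<bar>f p\<bar> + \<bar>g p\<bar>" by simp
    also have "\<dots> \<le> (SUP p. \<bar>f p\<bar>) + (SUP p. \<bar>g p\<bar>)"
      by (intro add_mono up C1_circle_bdd assms)
    finally show "\<bar>f p + g p\<bar> \<le> (SUP p. \<bar>f p\<bar>) + (SUP p. \<bar>g p\<bar>)" .
  qed simp
  moreover have "(SUP x. \<bar>deriv (f \<circ> to_circle) x + deriv (g \<circ> to_circle) x\<bar>) \<le>
      (SUP x. \<bar>deriv (f \<circ> to_circle) x\<bar>) + (SUP x. \<bar>deriv (g \<circ> to_circle) x\<bar>)"
    (is "_ \<le> ?R")
  proof (rule cSUP_least)
    fix x
    have "\<bar>deriv (f \<circ> to_circle) x + deriv (g \<circ> to_circle) x\<bar> \<le>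
        \<bar>deriv (f \<circ> to_circle) x\<bar> + \<bar>deriv (g \<circ> to_circle) x\<bar>" by simp
    also have "\<dots> \<le> ?R"
      by (intro add_mono up C1_circle_bdd assms)
    finally show "\<bar>deriv (f \<circ> to_circle) x + deriv (g \<circ> to_circle) x\<bar> \<le> ?R" .
  qed simp
  ultimately show ?thesis
    unfolding C1_norm_def d by linarith
qed

lemma C1_norm_diff_triangle:
  assumes "f \<in> C1_circle" "g \<in> C1_circle" "h \<in> C1_circle"
  shows "C1_norm (h - f) \<le> C1_norm (h - g) + C1_norm (g - f)"
proof -
  have "h - f = (\<lambda>p. (h - g) p + (g - f) p)"
    by auto
  then show ?thesis
    using C1_norm_triangle[of "h - g" "g - f"] assms by (simp add: C1_circle_diff)
qed

lemma C1_ball_self: "f \<in> C1_circle \<Longrightarrow> \<epsilon> > 0 \<Longrightarrow> f \<in> C1_ball f \<epsilon>"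
  using C1_norm_eq_0_iff[of "f - f"] C1_circle_diff[of f f]
  by (auto simp: C1_ball_def fun_eq_iff)

lemma openin_C1_topology:
  "openin C1_topology U \<longleftrightarrow>
     U \<subseteq> C1_circle \<and> (\<forall>f\<in>U. \<exists>\<epsilon>>0. C1_ball f \<epsilon> \<subseteq> U)" (is "_ \<longleftrightarrow> ?P U")
proof
  assume "openin C1_topology U"
  then have "generate_topology_on {C1_ball f \<epsilon> | f \<epsilon>. f \<in> C1_circle \<and> \<epsilon> > 0} U"
    by (simp add: C1_topology_def openin_topology_generated_by_iff)
  then show "?P U"
  proof induction
    case Empty
    then show ?case by simp
  next
    case (Int A B)
    show ?case
    proof (intro conjI ballI)
      show "A \<inter> B \<subseteq> C1_circle" using Int by blast
      fix f assume "f \<in> A \<inter> B"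
      then obtain a b where "a > 0" "b > 0" "C1_ball f a \<subseteq> A" "C1_ball f b \<subseteq> B"
        using Int by (meson IntD1 IntD2)
      then show "\<exists>\<epsilon>>0. C1_ball f \<epsilon> \<subseteq> A \<inter> B"
        by (intro exI[of _ "min a b"]) (auto simp: C1_ball_def)
    qed
  next
    case (UN K)
    then show ?case by (meson UnionE Union_upper Union_least order_trans)
  next
    case (Basis B)
    then obtain f0 e where B: "B = C1_ball f0 e" "f0 \<in> C1_circle" "e > 0"
      by blast
    show ?case
    proof (intro conjI ballI)
      show "B \<subseteq> C1_circle" by (auto simp: B C1_ball_def)
      fix f assume f: "f \<in> B"
      have "C1_ball f (e - C1_norm (f - f0)) \<subseteq> B"
      proof
        fix g assume "g \<in> C1_ball f (e - C1_norm (f - f0))"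
        then show "g \<in> B"
          using f C1_norm_diff_triangle[of f0 f g] by (auto simp: B C1_ball_def)
      qed
      then show "\<exists>\<epsilon>>0. C1_ball f \<epsilon> \<subseteq> B"
        using f by (intro exI[of _ "e - C1_norm (f - f0)"]) (auto simp: B C1_ball_def)
    qed
  qed
next
  assume U: "?P U"
  then obtain e where e: "\<And>f. f \<in> U \<Longrightarrow> e f > 0 \<and> C1_ball f (e f) \<subseteq> U"
    by metis
  have "U = (\<Union>f\<in>U. C1_ball f (e f))"
    using e C1_ball_self U by blast
  moreover have "openin C1_topology (C1_ball f (e f))" if "f \<in> U" for f
    unfolding C1_topology_def using that e U by (intro topology_generated_by_Basis) blast
  ultimately show "openin C1_topology U"
    by (metis (no_types, lifting) imageE openin_Union)
qed

lemma topspace_C1_topology: "topspace C1_topology = C1_circle"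
proof
  show "topspace C1_topology \<subseteq> C1_circle"
    using openin_C1_topology openin_topspace by blast
  have "openin C1_topology C1_circle"
    unfolding openin_C1_topology by (auto simp: C1_ball_def intro: exI[of _ 1])
  then show "C1_circle \<subseteq> topspace C1_topology"
    by (rule openin_subset)
qed

end

theory Submission
  imports Defs
begin

text \<open>
  Openness is formal: topological equivalence is an equivalence relation, so a ball of vector fields
  equivalent to its centre consists of structurally stable fields.

  Density rests on vector fields all of whose zeros are simple, meaning that the derivative does not
  vanish there. They are dense because, by Sard's theorem, arbitrarily small constants \<open>c\<close> are regular
  values of \<open>f\<close>, and then \<open>f - c\<close> has only simple zeros (\<open>simple_zeros_dense\<close>). It remains to see that
  a field \<open>f\<close> with simple zeros is structurally stable, and this has two parts.

  First, the phase portrait is determined by signs. A solution of a scalar equation is either constant at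
  a zero or sweeps monotonically over a whole gap between zeros, in the direction given by the sign of
  the field (\<open>flow_line_through_zero\<close>, \<open>range_increasing_flow_line\<close>). Up to reparametrisation,
  the orbits are thus the zeros and the gaps with their directions. Consequently an increasing homeomorphism \<open>H\<close> of
  the line that commutes with the unit translation and satisfies \<open>sgn (g (H x)) = sgn (f x)\<close> induces
  a topological equivalence (\<open>topologically_equivalent_if_sgn_conjugate\<close>). That the
  orbit of \<open>g\<close> through a given point exists is shown in \<open>flow_line_exists\<close>.

  Second, if \<open>g\<close> is close to \<open>f\<close> in the \<open>C\<^sup>1\<close> norm, every zero of \<open>f\<close> persists as exactly one nearby zero of
  \<open>g\<close> with the same sign change, and \<open>g\<close> has no other zeros. Adding to the identity a small
  tent at each zero of \<open>f\<close> yields the required \<open>H\<close>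
  (\<open>circle_homeo_moving_points\<close>, \<open>simple_zeros_sgn_conjugate\<close>). If \<open>f\<close> has no zeros, this \<open>H\<close> is the identity.
\<close>

section \<open>Solutions of scalar autonomous equations\<close>

definition flow_line :: "(real \<Rightarrow> real) \<Rightarrow> (real \<Rightarrow> real) \<Rightarrow> bool"
  where "flow_line F x \<longleftrightarrow> (\<forall>t. (x has_real_derivative F (x t)) (at t))"

lemma flow_line_reverse_time:
  assumes "flow_line F x"
  shows "flow_line (\<lambda>z. - F z) (\<lambda>t. x (- t))"
  unfolding flow_line_def
proof
  fix t
  have "(x has_real_derivative F (x (- t))) (at (- t))"
    using assms by (simp add: flow_line_def)
  then show "((\<lambda>t. x (- t)) has_real_derivative - F (x (- t))) (at t)"
    using DERIV_mirror[of x "F (x (- t))" t] by simp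
qed

lemma flow_line_reflect:
  assumes "flow_line F x"
  shows "flow_line (\<lambda>z. - F (- z)) (\<lambda>t. - x t)"
  using assms unfolding flow_line_def by (auto intro!: derivative_eq_intros)

lemma flow_line_continuous: "flow_line F x \<Longrightarrow> continuous_on A x"
  unfolding flow_line_def by (meson DERIV_isCont continuous_at_imp_continuous_on)

text \<open>Equilibria cannot be reached in finite time. With \<open>u\<close> the squared distance to the equilibrium,
  the Lipschitz bound gives \<open>\<bar>u'\<bar> \<le> 2 L u\<close>, so \<open>u t * exp (- 2 L t)\<close> is nonincreasing and
  \<open>u t * exp (2 L t)\<close> is nondecreasing; \<open>u\<close> vanishes at time \<open>s\<close>, hence later by the former
  and earlier by the latter.\<close>

lemma flow_line_through_zero:
  assumes x: "flow_line F x" and F: "L-lipschitz_on UNIV F" and z: "F (x s) = 0"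
  shows "x t = x s"
proof -
  define u where "u t = (x t - x s)\<^sup>2" for t
  have der: "(u has_real_derivative 2 * (x t - x s) * F (x t)) (at t)" for t
    using x unfolding flow_line_def u_def by (auto intro!: derivative_eq_intros)
  have bound: "\<bar>2 * (x t - x s) * F (x t)\<bar> \<le> 2 * L * u t" for t
  proof -
    have "\<bar>F (x t)\<bar> \<le> L * \<bar>x t - x s\<bar>"
      using lipschitz_onD[OF F, of "x t" "x s"] z by (simp add: dist_real_def)
    then have "\<bar>x t - x s\<bar> * \<bar>F (x t)\<bar> \<le> \<bar>x t - x s\<bar> * (L * \<bar>x t - x s\<bar>)"
      by (intro mult_left_mono) auto
    also have "\<dots> = L * \<bar>x t - x s\<bar>\<^sup>2"
      by (simp add: power2_eq_square del: abs_mult_self_eq)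
    finally have "\<bar>(x t - x s) * F (x t)\<bar> \<le> L * u t"
      by (simp add: abs_mult u_def)
    moreover have "\<bar>2 * (x t - x s) * F (x t)\<bar> = 2 * \<bar>(x t - x s) * F (x t)\<bar>"
      by (simp only: abs_mult mult.assoc abs_numeral)
    ultimately show ?thesis by simp
  qed
  have "u t \<le> 0"
  proof (cases "s \<le> t")
    case True
    have "u t * exp (- 2 * L * t) \<le> u s * exp (- 2 * L * s)"
    proof (rule DERIV_nonpos_imp_nonincreasing[OF True])
      fix r
      have "((\<lambda>r. u r * exp (- 2 * L * r)) has_real_derivative
          (2 * (x r - x s) * F (x r) - 2 * L * u r) * exp (- 2 * L * r)) (at r)"
        by (auto intro!: derivative_eq_intros der simp: algebra_simps)
      moreover have "(2 * (x r - x s) * F (x r) - 2 * L * u r) * exp (- 2 * L * r) \<le> 0"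
        using bound[of r] by (intro mult_nonpos_nonneg) auto
      ultimately show "\<exists>y. ((\<lambda>r. u r * exp (- 2 * L * r)) has_real_derivative y) (at r) \<and> y \<le> 0"
        by blast
    qed
    then show ?thesis by (simp add: u_def mult_le_0_iff not_le)
  next
    case False
    then have "t \<le> s" by simp
    have "u t * exp (2 * L * t) \<le> u s * exp (2 * L * s)"
    proof (rule DERIV_nonneg_imp_nondecreasing[OF \<open>t \<le> s\<close>])
      fix r
      have "((\<lambda>r. u r * exp (2 * L * r)) has_real_derivative
          (2 * (x r - x s) * F (x r) + 2 * L * u r) * exp (2 * L * r)) (at r)"
        by (auto intro!: derivative_eq_intros der simp: algebra_simps)
      moreover have "(2 * (x r - x s) * F (x r) + 2 * L * u r) * exp (2 * L * r) \<ge> 0"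
        using bound[of r] by (intro mult_nonneg_nonneg) auto
      ultimately show "\<exists>y. ((\<lambda>r. u r * exp (2 * L * r)) has_real_derivative y) (at r) \<and> y \<ge> 0"
        by blast
    qed
    then show ?thesis by (simp add: u_def mult_le_0_iff not_le)
  qed
  then show ?thesis by (simp add: u_def)
qed

lemma range_flow_line_convex:
  assumes "flow_line F x"
  shows "closed_segment (x s) (x t) \<subseteq> range x"
proof -
  have "connected (range x)"
    using flow_line_continuous[OF assms] by (intro connected_continuous_image) auto
  then show ?thesis
    by (metis convex_contains_segment is_interval_connected_1 is_interval_convex_1 rangeI)
qed

text \<open>Along a nonconstant solution the velocity never vanishes, so it keeps its sign.\<close>

lemma flow_line_strict_mono:
  assumes x: "flow_line F x" and F: "L-lipschitz_on UNIV F" and pos: "F (x 0) > 0"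
  shows "strict_mono x" "F (x t) > 0"
proof -
  have pos_all: "F (x t) > 0" for t
  proof (rule ccontr)
    assume neg: "\<not> F (x t) > 0"
    have "continuous_on UNIV (F \<circ> x)"
      using flow_line_continuous[OF x] lipschitz_on_continuous_on[OF F]
      by (intro continuous_on_compose) (auto intro: continuous_on_subset)
    then have "connected (range (F \<circ> x))"
      by (intro connected_continuous_image) auto
    then have "0 \<in> range (F \<circ> x)"
      using pos neg connectedD_interval[of "range (F \<circ> x)" "F (x t)" "F (x 0)" 0] by auto
    then obtain s where "F (x s) = 0" by auto
    then show False
      using flow_line_through_zero[OF x F, of s 0] pos by simp
  qed
  show "F (x t) > 0" by (rule pos_all)
  show "strict_mono x"
  proof (rule strict_monoI)
    fix a b :: real assume "a < b"
    then show "x a < x b"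
      by (rule DERIV_pos_imp_increasing) (use x pos_all in \<open>auto simp: flow_line_def\<close>)
  qed
qed

lemma flow_line_reaches_forward:
  assumes x: "flow_line F x" and F: "L-lipschitz_on UNIV F"
    and y: "x 0 \<le> y" and pos: "\<And>z. x 0 \<le> z \<Longrightarrow> z \<le> y \<Longrightarrow> F z > 0"
  shows "y \<in> range x"
proof -
  have "\<exists>m\<in>{x 0..y}. \<forall>z\<in>{x 0..y}. F m \<le> F z"
    using y lipschitz_on_continuous_on[OF F]
    by (intro continuous_attains_inf) (auto intro: continuous_on_subset)
  then obtain m where m: "m > 0" "\<And>z. x 0 \<le> z \<Longrightarrow> z \<le> y \<Longrightarrow> m \<le> F z"
    using pos by force
  have mono: "strict_mono x"
    by (rule flow_line_strict_mono[OF x F]) (use pos y in auto)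
  \<comment> \<open>As long as the solution stays below \<open>y\<close> its speed is at least \<open>m\<close>.\<close>
  define T where "T = (y - x 0) / m"
  have T: "T \<ge> 0" using y m by (simp add: T_def)
  have "y \<le> x T"
  proof (rule ccontr)
    assume "\<not> y \<le> x T"
    have "x 0 - m * 0 \<le> x T - m * T"
    proof (rule DERIV_nonneg_imp_nondecreasing[OF T])
      fix r assume "0 \<le> r" "r \<le> T"
      then have "x 0 \<le> x r" "x r \<le> x T"
        by (simp_all add: strict_mono_less_eq[OF mono])
      then have "m \<le> F (x r)"
        using \<open>\<not> y \<le> x T\<close> by (intro m) auto
      moreover have "((\<lambda>r. x r - m * r) has_real_derivative F (x r) - m) (at r)"
        using x unfolding flow_line_def by (auto intro!: derivative_eq_intros)
      ultimately show "\<exists>d. ((\<lambda>r. x r - m * r) has_real_derivative d) (at r) \<and> 0 \<le> d"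
        by force
    qed
    then show False
      using m \<open>\<not> y \<le> x T\<close> by (simp add: T_def)
  qed
  then have "y \<in> closed_segment (x 0) (x T)"
    using y by (simp add: closed_segment_eq_real_ivl)
  then show ?thesis
    using range_flow_line_convex[OF x] by blast
qed

text \<open>For \<open>F c \<noteq> 0\<close> this is the connected component of \<open>c\<close> in the complement of the zero set.
  Describing it by segments makes its behaviour under increasing bijections immediate.\<close>

definition zero_free_interval :: "(real \<Rightarrow> real) \<Rightarrow> real \<Rightarrow> real set"
  where "zero_free_interval F c = {y. \<forall>z\<in>closed_segment c y. F z \<noteq> 0}"

lemma sign_constant_on_segment:
  fixes F :: "real \<Rightarrow> real"
  assumes "continuous_on UNIV F" "\<And>z. z \<in> closed_segment c y \<Longrightarrow> F z \<noteq> 0" "F c > 0"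
    "z \<in> closed_segment c y"
  shows "F z > 0"
proof (rule ccontr)
  assume "\<not> F z > 0"
  have "connected (F ` closed_segment c y)"
    by (intro connected_continuous_image continuous_on_subset[OF assms(1)]) auto
  then have "0 \<in> F ` closed_segment c y"
    using assms \<open>\<not> F z > 0\<close> connectedD_interval[of "F ` closed_segment c y" "F z" "F c" 0]
    by auto
  then show False using assms by auto
qed

text \<open>A nonconstant orbit is a whole gap between zeros: the solution cannot cross a zero, and on a
  compact part of the gap its speed is bounded below, so it gets past every point. Backward time
  is reduced to forward time by reversing both the time and the space variable.\<close>

lemma range_increasing_flow_line:
  assumes x: "flow_line F x" and F: "L-lipschitz_on UNIV F" and pos: "F (x 0) > 0"
  shows "range x = zero_free_interval F (x 0)"
proof (intro equalityI subsetI)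
  fix y assume "y \<in> range x"
  then have "closed_segment (x 0) y \<subseteq> range x"
    using range_flow_line_convex[OF x] by auto
  then show "y \<in> zero_free_interval F (x 0)"
    using flow_line_strict_mono(2)[OF x F pos] unfolding zero_free_interval_def
    by (smt (verit) mem_Collect_eq rangeE subsetD)
next
  fix y assume "y \<in> zero_free_interval F (x 0)"
  then have pos': "F z > 0" if "z \<in> closed_segment (x 0) y" for z
    using sign_constant_on_segment[OF lipschitz_on_continuous_on[OF F] _ pos that]
    by (auto simp: zero_free_interval_def)
  show "y \<in> range x"
  proof (cases "x 0 \<le> y")
    case True
    then show ?thesis
      using pos' by (intro flow_line_reaches_forward[OF x F]) (auto simp: closed_segment_eq_real_ivl)
  next
    case False
    have "flow_line (\<lambda>z. F (- z)) (\<lambda>t. - x (- t))"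
      using flow_line_reflect[OF flow_line_reverse_time[OF x]] by simp
    moreover have "L-lipschitz_on UNIV (\<lambda>z. F (- z))"
      using lipschitz_onD[OF F, of "- _" "- _"] lipschitz_on_nonneg[OF F]
      by (intro lipschitz_onI) (simp_all add: dist_minus)
    ultimately have "- y \<in> range (\<lambda>t. - x (- t))"
      by (rule flow_line_reaches_forward)
        (use False in \<open>auto intro!: pos' simp: closed_segment_eq_real_ivl\<close>)
    then show ?thesis by auto
  qed
qed

lemma range_reverse_time: "range (\<lambda>t::real. x (- t)) = range x"
  by (auto simp: image_iff) (metis minus_minus)

lemma range_decreasing_flow_line:
  assumes x: "flow_line F x" and F: "L-lipschitz_on UNIV F" and neg: "F (x 0) < 0"
  shows "strict_mono (\<lambda>t. x (- t))" "range x = zero_free_interval F (x 0)"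
proof -
  note x' = flow_line_reverse_time[OF x]
  have F': "L-lipschitz_on UNIV (\<lambda>z. - F z)"
    using F by (simp add: lipschitz_on_minus)
  show "strict_mono (\<lambda>t. x (- t))"
    using flow_line_strict_mono(1)[OF x' F'] neg by simp
  have "range (\<lambda>t. x (- t)) = zero_free_interval (\<lambda>z. - F z) (x 0)"
    using range_increasing_flow_line[OF x' F'] neg by simp
  then show "range x = zero_free_interval F (x 0)"
    by (simp add: zero_free_interval_def range_reverse_time)
qed

text \<open>This is the estimate that turns the Picard operator into a contraction for the norm weighted by
  \<open>exp (- k \<bar>t\<bar>)\<close>: integration from \<open>0\<close> gains a factor \<open>1 / k\<close>.\<close>

lemma exponential_growth_bound:
  fixes D e :: "real \<Rightarrow> real"
  assumes D: "\<And>t. (D has_real_derivative e t) (at t)" "D 0 = 0"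
    and e: "\<And>t. \<bar>e t\<bar> \<le> B * exp (k * \<bar>t\<bar>)" and k: "k > 0"
  shows "\<bar>D t\<bar> \<le> B / k * exp (k * \<bar>t\<bar>)"
proof -
  have B: "B \<ge> 0" using e[of 0] by simp
  have bound: "D t \<le> B / k * exp (k * t)"
    if "t \<ge> 0" and D: "\<And>t. (D has_real_derivative e t) (at t)" "D 0 = 0"
      and e: "\<And>t. \<bar>e t\<bar> \<le> B * exp (k * \<bar>t\<bar>)" for D e t
  proof -
    have "B / k * exp (k * 0) - D 0 \<le> B / k * exp (k * t) - D t"
    proof (rule DERIV_nonneg_imp_nondecreasing[OF that(1)])
      fix r assume "0 \<le> r" "r \<le> t"
      have "((\<lambda>r. B / k * exp (k * r)) has_real_derivative B * exp (k * r)) (at r)"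
        using k by (auto intro!: derivative_eq_intros)
      then have "((\<lambda>r. B / k * exp (k * r) - D r) has_real_derivative B * exp (k * r) - e r) (at r)"
        by (rule DERIV_diff[OF _ D(1)])
      moreover have "B * exp (k * r) - e r \<ge> 0"
        using e[of r] \<open>0 \<le> r\<close> by simp
      ultimately show "\<exists>d. ((\<lambda>r. B / k * exp (k * r) - D r) has_real_derivative d) (at r) \<and> 0 \<le> d"
        by blast
    qed
    then show ?thesis using D(2) divide_nonneg_pos[OF B k] by simp
  qed
  have refl: "((\<lambda>t. D (- t)) has_real_derivative - e (- t)) (at t)" for t
    using D(1)[of "- t"] by (simp add: DERIV_mirror)
  have refl': "((\<lambda>t. - D (- t)) has_real_derivative e (- t)) (at t)" for t
    using DERIV_minus[OF refl, of t] by simp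
  have e': "\<bar>e (- t)\<bar> \<le> B * exp (k * \<bar>t\<bar>)" for t
    using e[of "- t"] by simp
  have minus: "((\<lambda>t. - D t) has_real_derivative - e t) (at t)" for t
    by (rule DERIV_minus[OF D(1)])
  have "\<bar>D t\<bar> \<le> B / k * exp (k * t)" if "t \<ge> 0" for t
  proof (rule abs_leI)
    show "D t \<le> B / k * exp (k * t)"
      by (rule bound[OF that D e])
    show "- D t \<le> B / k * exp (k * t)"
      by (rule bound[of _ "\<lambda>t. - D t", OF that minus]) (use D(2) e in simp_all)
  qed
  moreover have "\<bar>D (- t)\<bar> \<le> B / k * exp (k * t)" if "t \<ge> 0" for t
  proof (rule abs_leI)
    show "D (- t) \<le> B / k * exp (k * t)"
      by (rule bound[of _ "\<lambda>t. D (- t)", OF that refl]) (use D(2) e' in simp_all)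
    show "- D (- t) \<le> B / k * exp (k * t)"
      by (rule bound[of _ "\<lambda>t. - D (- t)", OF that refl']) (use D(2) e' in simp_all)
  qed
  from calculation this[of "- t"] show ?thesis
    by (cases "t \<ge> 0") auto
qed

lemma ex_primitive:
  fixes u :: "real \<Rightarrow> real"
  assumes "continuous_on UNIV u"
  shows "\<exists>A. A 0 = 0 \<and> (\<forall>t. (A has_real_derivative u t) (at t))"
proof -
  have "isCont u t" for t
    using assms by (simp add: continuous_on_eq_continuous_at)
  then obtain A where "\<And>t. (A has_vector_derivative u t) (at t)"
    using einterval_antiderivative[of "-\<infinity>" "\<infinity>" u] by auto
  then have A: "(A has_real_derivative u t) (at t)" for t
    by (simp add: has_real_derivative_iff_has_vector_derivative)
  have "((\<lambda>t. A t - A 0) has_real_derivative u t) (at t)" for t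
    using DERIV_diff[OF A[of t] DERIV_const[of "A 0"]] by simp
  then show ?thesis
    by (intro exI[of _ "\<lambda>t. A t - A 0"]) simp
qed

text \<open>Global existence by a single application of Banach's fixed point theorem. The solution is sought
  as \<open>c + exp (k \<bar>t\<bar>) * w t\<close> with \<open>w\<close> bounded and continuous. In the variable \<open>w\<close> the integral
  operator is Lipschitz with constant \<open>L / k\<close>, which is below \<open>1\<close> for the weight chosen in the proof,
  so no gluing of local solutions is necessary.\<close>

lemma flow_line_exists:
  assumes F: "L-lipschitz_on UNIV F" and M: "\<And>z. \<bar>F z\<bar> \<le> M"
  obtains x where "flow_line F x" "x 0 = c"
proof -
  define k where "k = 2 * L + 1"
  have L: "L \<ge> 0" using F by (rule lipschitz_on_nonneg)
  have k: "k > 0" using L by (simp add: k_def)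
  have M0: "M \<ge> 0" using M[of 0] by simp
  \<comment> \<open>\<open>P w\<close> is the integral of the vector field along the curve encoded by \<open>w\<close>, and \<open>Q w\<close> is the same
    function in the weighted variable.\<close>
  define u where "u w t = F (c + exp (k * \<bar>t\<bar>) * apply_bcontfun w t)" for w t
  have "continuous_on UNIV (u w)" for w
    unfolding u_def
    by (rule continuous_on_compose2[OF lipschitz_on_continuous_on[OF F]])
      (auto intro!: continuous_intros)
  then have "\<exists>P. \<forall>w. P w 0 = 0 \<and> (\<forall>t. (P w has_real_derivative u w t) (at t))"
    by (intro choice allI ex_primitive)
  then obtain P where P: "\<And>w. P w 0 = 0"
      "\<And>w t. (P w has_real_derivative u w t) (at t)"
    by blast
  define Q where "Q w t = exp (- k * \<bar>t\<bar>) * P w t" for w t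
  have scale: "\<bar>exp (- k * \<bar>t\<bar>) * y\<bar> \<le> b" if "\<bar>y\<bar> \<le> b * exp (k * \<bar>t\<bar>)" for t y b
    using that by (simp add: abs_mult exp_minus divide_simps)
  have "Q w \<in> bcontfun" for w
  proof (rule bcontfun_normI)
    show "continuous_on UNIV (Q w)"
      unfolding Q_def using P(2)
      by (intro continuous_intros) (meson DERIV_isCont continuous_at_imp_continuous_on)
    have "\<bar>u w t\<bar> \<le> M * exp (k * \<bar>t\<bar>)" for t
    proof -
      have "M * 1 \<le> M * exp (k * \<bar>t\<bar>)"
        using M0 k by (intro mult_left_mono) auto
      then show ?thesis using M unfolding u_def by (smt (verit))
    qed
    from exponential_growth_bound[OF P(2) P(1) this k]
    show "norm (Q w t) \<le> M / k" for t
      unfolding Q_def real_norm_def by (rule scale)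
  qed
  then have app: "apply_bcontfun (Bcontfun (Q w)) t = Q w t" for w t
    by (simp add: Bcontfun_inverse)
  have contraction: "dist (Bcontfun (Q v)) (Bcontfun (Q w)) \<le> L / k * dist v w" for v w
  proof (rule dist_bound)
    fix t
    have "\<bar>u v t - u w t\<bar> \<le> L * dist v w * exp (k * \<bar>t\<bar>)" for t
    proof -
      have "\<bar>u v t - u w t\<bar> \<le> L * \<bar>exp (k * \<bar>t\<bar>) * v t - exp (k * \<bar>t\<bar>) * w t\<bar>"
        using lipschitz_onD[OF F, of "c + exp (k * \<bar>t\<bar>) * v t" "c + exp (k * \<bar>t\<bar>) * w t"]
        by (simp add: u_def dist_real_def)
      also have "\<dots> = L * exp (k * \<bar>t\<bar>) * dist (v t) (w t)"
        by (simp only: dist_real_def abs_mult right_diff_distrib[symmetric] abs_exp_cancel mult.assoc)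
      also have "\<dots> \<le> L * exp (k * \<bar>t\<bar>) * dist v w"
        using L by (intro mult_left_mono dist_bounded) auto
      finally show ?thesis by (simp add: ac_simps)
    qed
    then have "\<bar>P v t - P w t\<bar> \<le> L * dist v w / k * exp (k * \<bar>t\<bar>)"
      by (intro exponential_growth_bound[where e = "\<lambda>t. u v t - u w t"] DERIV_diff P(2) k)
        (simp_all add: P(1))
    then have "\<bar>P v t - P w t\<bar> \<le> L / k * dist v w * exp (k * \<bar>t\<bar>)"
      by simp
    then have "\<bar>exp (- k * \<bar>t\<bar>) * (P v t - P w t)\<bar> \<le> L / k * dist v w"
      by (rule scale)
    then show "dist (apply_bcontfun (Bcontfun (Q v)) t) (apply_bcontfun (Bcontfun (Q w)) t)
        \<le> L / k * dist v w"
      by (simp only: app Q_def dist_real_def right_diff_distrib)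
  qed
  have "\<exists>!w. Bcontfun (Q w) = w"
    by (rule banach_fix_type[of "L / k"]) (use L contraction in \<open>auto simp: k_def\<close>)
  then obtain w where "Bcontfun (Q w) = w" by blast
  then have w: "exp (k * \<bar>t\<bar>) * apply_bcontfun w t = P w t" for t
    using app[of w t] by (auto simp: Q_def exp_minus)
  show thesis
  proof
    show "flow_line F (\<lambda>t. c + P w t)"
      unfolding flow_line_def using DERIV_add[OF DERIV_const P(2)[of w]] by (simp add: u_def w)
  qed (simp add: P)
qed

text \<open>Two monotone parametrisations of the same interval differ by a change of time; it is the source of
  all reparametrisations of orbits below.\<close>

lemma strict_mono_same_range:
  fixes u y :: "real \<Rightarrow> real"
  assumes u: "strict_mono u" and y: "strict_mono y" and r: "range u = range y"
  obtains \<tau> where "strict_mono \<tau>" "surj \<tau>" "u = y \<circ> \<tau>"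
proof
  define \<tau> where "\<tau> = inv y \<circ> u"
  have injs: "inj u" "inj y" using u y by (simp_all add: strict_mono_imp_inj_on)
  have yt: "y (\<tau> t) = u t" for t
    unfolding \<tau>_def comp_def by (rule f_inv_into_f) (use r in blast)
  then show "u = y \<circ> \<tau>" by auto
  show "strict_mono \<tau>"
    using u strict_mono_less[OF y] by (simp add: strict_mono_def flip: yt)
  show "surj \<tau>"
  proof
    show "UNIV \<subseteq> range \<tau>"
    proof
      fix s
      obtain t where "u t = y s" using r by (metis rangeE rangeI)
      then have "\<tau> t = s" using yt[of t] injs by (metis injD)
      then show "s \<in> range \<tau>" by auto
    qed
  qed simp
qed

section \<open>Flows of vector fields on the circle\<close>

lemma C1_circle_lift_lipschitz:
  assumes "f \<in> C1_circle"
  obtains L where "L-lipschitz_on UNIV (f \<circ> to_circle)"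
proof
  show "(C1_norm f)-lipschitz_on UNIV (f \<circ> to_circle)"
  proof (rule bounded_derivative_imp_lipschitz)
    show "((f \<circ> to_circle) has_derivative (*) (deriv (f \<circ> to_circle) x)) (at x within UNIV)" for x
      using C1_circle_has_derivative[OF assms, of x] by (simp add: has_field_derivative_def)
    show "onorm ((*) (deriv (f \<circ> to_circle) x)) \<le> C1_norm f" for x
    proof (rule onorm_bound)
      show "norm (deriv (f \<circ> to_circle) x * y) \<le> C1_norm f * norm y" for y
        using C1_norm_upper[OF assms, of undefined x]
        by (simp add: abs_mult mult_right_mono)
    qed (rule C1_norm_nonneg[OF assms])
  qed (use C1_norm_nonneg[OF assms] in auto)
qed

lemma C1_circle_flow_line_exists:
  assumes "f \<in> C1_circle"
  obtains x where "flow_line (f \<circ> to_circle) x" "x 0 = c"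
proof -
  obtain L where "L-lipschitz_on UNIV (f \<circ> to_circle)"
    using C1_circle_lift_lipschitz[OF assms] .
  moreover have "\<bar>(f \<circ> to_circle) z\<bar> \<le> C1_norm f" for z
    using C1_norm_upper[OF assms, of "to_circle z" 0] by simp
  ultimately show thesis
    using flow_line_exists that by blast
qed

lemma solution_iff_flow_line:
  "solution f \<phi> \<longleftrightarrow> (\<exists>x. \<phi> = to_circle \<circ> x \<and> flow_line (f \<circ> to_circle) x)"
  by (simp add: solution_def flow_line_def)

section \<open>Circle homeomorphisms and their lifts\<close>

definition lift_of_circle_homeo :: "(real \<Rightarrow> real) \<Rightarrow> bool"
  where "lift_of_circle_homeo H \<longleftrightarrow> strict_mono H \<and> surj H \<and> (\<forall>x. H (x + 1) = H x + 1)"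

text \<open>The value does not depend on the representative when \<open>H\<close> commutes with the unit translation; see
  \<open>on_circle_to_circle\<close>.\<close>

definition on_circle :: "(real \<Rightarrow> real) \<Rightarrow> circle \<Rightarrow> circle"
  where "on_circle H p = to_circle (H (rep_circle p))"

lemma lift_add_int:
  assumes "lift_of_circle_homeo H"
  shows "H (x + of_int n) = H x + of_int n"
proof -
  have nat: "H (x + of_nat n) = H x + of_nat n" for x n
  proof (induction n)
    case (Suc n)
    then show ?case
      using assms unfolding lift_of_circle_homeo_def
      by (metis add.assoc of_nat_Suc add.commute)
  qed simp
  show ?thesis
  proof (cases n)
    case (nonneg m)
    then show ?thesis using nat by simp
  next
    case (neg m)
    then have "x + of_int n + of_nat (Suc m) = x" by simp
    then have "H x = H (x + of_int n) + of_nat (Suc m)"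
      by (metis nat)
    then show ?thesis using neg by simp
  qed
qed

lemma on_circle_to_circle:
  assumes "lift_of_circle_homeo H"
  shows "on_circle H (to_circle x) = to_circle (H x)"
proof -
  have "to_circle (rep_circle (to_circle x)) = to_circle x"
    by (rule Quotient3_abs_rep[OF Quotient3_circle])
  then obtain n where "rep_circle (to_circle x) - x = of_int n"
    by (auto simp: to_circle_eq_iff elim: Ints_cases)
  then have "rep_circle (to_circle x) = x + of_int n" by simp
  then show ?thesis
    by (simp add: on_circle_def lift_add_int[OF assms] to_circle_eq_iff)
qed

lemma lift_inv:
  assumes "lift_of_circle_homeo H"
  shows "lift_of_circle_homeo (inv H)"
proof -
  have H: "strict_mono H" "surj H" "H (x + 1) = H x + 1" for x
    using assms by (auto simp: lift_of_circle_homeo_def)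
  have "inj H" using H(1) by (rule strict_mono_imp_inj_on)
  have "strict_mono (inv H)"
  proof (rule strict_monoI)
    fix a b :: real assume "a < b"
    then show "inv H a < inv H b"
      using strict_mono_less[OF H(1), of "inv H a" "inv H b"] by (simp add: surj_f_inv_f[OF H(2)])
  qed
  moreover have "inv H (x + 1) = inv H x + 1" for x
    using H by (intro inv_f_eq[OF \<open>inj H\<close>]) (simp add: surj_f_inv_f)
  ultimately show ?thesis
    using \<open>inj H\<close> by (simp add: lift_of_circle_homeo_def inj_imp_surj_inv)
qed

lemma lift_continuous: "lift_of_circle_homeo H \<Longrightarrow> continuous_on UNIV H"
  unfolding lift_of_circle_homeo_def
  by (intro continuous_onI_mono) (auto simp: strict_mono_less_eq)

lemma continuous_on_circle:
  assumes "lift_of_circle_homeo H"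
  shows "continuous_on UNIV (on_circle H)"
proof -
  have "continuous_on UNIV (to_circle \<circ> H)"
    using lift_continuous[OF assms] continuous_on_to_circle
    by (intro continuous_on_compose) (auto intro: continuous_on_subset)
  moreover have "on_circle H \<circ> to_circle = to_circle \<circ> H"
    by (auto simp: on_circle_to_circle[OF assms])
  ultimately show ?thesis by (simp add: continuous_on_circle_iff)
qed

lemma on_circle_inverse:
  assumes "lift_of_circle_homeo H"
  shows "on_circle H (on_circle (inv H) p) = p" "on_circle (inv H) (on_circle H p) = p"
proof -
  obtain x where x: "p = to_circle x" using surj_to_circle by (metis surjD)
  have H: "surj H" "inj H"
    using assms by (auto simp: lift_of_circle_homeo_def strict_mono_imp_inj_on)
  show "on_circle H (on_circle (inv H) p) = p" "on_circle (inv H) (on_circle H p) = p"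
    using H by (simp_all add: x on_circle_to_circle[OF assms] on_circle_to_circle[OF lift_inv[OF assms]]
        surj_f_inv_f inv_f_f)
qed

lemma homeomorphism_on_circle:
  assumes "lift_of_circle_homeo H"
  shows "homeomorphism UNIV UNIV (on_circle H) (on_circle (inv H))"
  by (intro homeomorphismI continuous_on_circle lift_inv assms on_circle_inverse subset_UNIV)

section \<open>Topological equivalence through signs\<close>

lemma image_oriented_curve: "(\<lambda>\<gamma>. h \<circ> \<gamma>) ` oriented_curve \<phi> = oriented_curve (h \<circ> \<phi>)"
  unfolding oriented_curve_def by (auto simp: comp_assoc)

lemma oriented_curve_reparametrised:
  assumes "strict_mono \<tau>" "surj \<tau>"
  shows "oriented_curve (\<phi> \<circ> \<tau>) = oriented_curve \<phi>"
proof -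
  have sub: "oriented_curve (\<phi> \<circ> \<tau>) \<subseteq> oriented_curve \<phi>"
    if "strict_mono \<tau>" "surj \<tau>" for \<phi> :: "real \<Rightarrow> circle" and \<tau>
  proof
    fix \<gamma> assume "\<gamma> \<in> oriented_curve (\<phi> \<circ> \<tau>)"
    then obtain \<rho> where "strict_mono \<rho>" "surj \<rho>" "\<gamma> = \<phi> \<circ> (\<tau> \<circ> \<rho>)"
      by (auto simp: oriented_curve_def comp_assoc)
    moreover from this have "strict_mono (\<tau> \<circ> \<rho>)" "surj (\<tau> \<circ> \<rho>)"
      using strict_mono_o[OF that(1)] comp_surj[OF _ that(2)] by blast+
    ultimately show "\<gamma> \<in> oriented_curve \<phi>"
      unfolding oriented_curve_def by blast
  qed
  obtain \<sigma> where \<sigma>: "strict_mono \<sigma>" "surj \<sigma>" "id = \<tau> \<circ> \<sigma>"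
    using strict_mono_same_range[of id \<tau>] assms by (auto simp: strict_mono_def)
  have "oriented_curve ((\<phi> \<circ> \<tau>) \<circ> \<sigma>) \<subseteq> oriented_curve (\<phi> \<circ> \<tau>)"
    by (rule sub[OF \<sigma>(1,2)])
  then have "oriented_curve \<phi> \<subseteq> oriented_curve (\<phi> \<circ> \<tau>)"
    by (simp add: comp_assoc flip: \<sigma>(3))
  then show ?thesis using sub[OF assms] by blast
qed

lemma image_closed_segment_mono:
  fixes H :: "real \<Rightarrow> real"
  assumes "strict_mono H" "surj H"
  shows "H ` closed_segment a b = closed_segment (H a) (H b)"
proof -
  have "H ` {a..b} = {H a..H b}" for a b
  proof
    show "{H a..H b} \<subseteq> H ` {a..b}"
    proof
      fix y assume y: "y \<in> {H a..H b}"
      obtain x where "y = H x" using \<open>surj H\<close> by (metis surjD)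
      then show "y \<in> H ` {a..b}"
        using y by (simp add: strict_mono_less_eq[OF assms(1)])
    qed
  qed (auto simp: strict_mono_less_eq[OF assms(1)])
  then show ?thesis
    by (simp add: closed_segment_eq_real_ivl strict_mono_less_eq[OF assms(1)])
qed

lemma image_zero_free_interval:
  assumes H: "strict_mono H" "surj H" and zero: "\<And>x. G (H x) = 0 \<longleftrightarrow> F x = 0"
  shows "H ` zero_free_interval F c = zero_free_interval G (H c)"
proof -
  have "H y \<in> zero_free_interval G (H c) \<longleftrightarrow> y \<in> zero_free_interval F c" for y
    by (simp add: zero_free_interval_def zero flip: image_closed_segment_mono[OF H])
  then show ?thesis
    using \<open>surj H\<close> by (auto simp: image_iff) (metis surjD)
qed

text \<open>An increasing bijection that respects the signs of the two vector fields maps zeros to zeros and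
  gaps to gaps, together with the direction of motion. The image of an orbit of \<open>F\<close> and the orbit
  of \<open>G\<close> through the image point are therefore monotone in the same direction with the same range, and
  such parametrisations differ by a change of time. Decreasing solutions are made increasing by
  reversing time.\<close>

lemma flow_lines_conjugate:
  assumes H: "strict_mono H" "surj H" and sgn: "\<And>x. sgn (G (H x)) = sgn (F x)"
    and F: "L-lipschitz_on UNIV F" and G: "K-lipschitz_on UNIV G"
    and x: "flow_line F x" and y: "flow_line G y" and y0: "y 0 = H (x 0)"
  obtains \<tau> where "strict_mono \<tau>" "surj \<tau>" "H \<circ> x = y \<circ> \<tau>"
proof -
  have zero: "G (H x) = 0 \<longleftrightarrow> F x = 0" for x
    using sgn[of x] by (metis sgn_0_0)
  have "H ` zero_free_interval F (x 0) = zero_free_interval G (y 0)"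
    unfolding y0 by (rule image_zero_free_interval) (use H zero in auto)
  then have range: "range (H \<circ> x) = range y"
    if "range x = zero_free_interval F (x 0)" "range y = zero_free_interval G (y 0)"
    using that by (simp only: image_comp[symmetric])
  consider "F (x 0) = 0" | "F (x 0) > 0" | "F (x 0) < 0" by linarith
  then show thesis
  proof cases
    case 1
    then have "(H \<circ> x) t = y t" for t
      using flow_line_through_zero[OF x F, of 0 t] flow_line_through_zero[OF y G, of 0 t] zero y0
      by auto
    then have "H \<circ> x = y \<circ> id" by auto
    then show thesis
      using that[of id] by (auto simp: strict_mono_def)
  next
    case 2
    then have pos: "G (y 0) > 0"
      using sgn[of "x 0"] y0 by (metis sgn_greater)
    have "range (H \<circ> x) = range y"
      using range_increasing_flow_line[OF x F 2] range_increasing_flow_line[OF y G pos]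
      by (rule range)
    moreover have "strict_mono (H \<circ> x)"
      using H(1) flow_line_strict_mono(1)[OF x F 2] by (rule strict_mono_o)
    ultimately show thesis
      using that strict_mono_same_range flow_line_strict_mono(1)[OF y G pos] by blast
  next
    case 3
    then have neg: "G (y 0) < 0"
      using sgn[of "x 0"] y0 by (metis sgn_less)
    have "range (H \<circ> x) = range y"
      using range_decreasing_flow_line(2)[OF x F 3] range_decreasing_flow_line(2)[OF y G neg]
      by (rule range)
    then have "range (\<lambda>t. (H \<circ> x) (- t)) = range (\<lambda>t. y (- t))"
      by (simp add: range_reverse_time[of "H \<circ> x", simplified] range_reverse_time)
    moreover have "strict_mono (\<lambda>t. (H \<circ> x) (- t))"
      using strict_mono_o[OF H(1) range_decreasing_flow_line(1)[OF x F 3]] by (simp add: comp_def)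
    ultimately obtain \<tau> where \<tau>: "strict_mono \<tau>" "surj \<tau>"
        "(\<lambda>t. (H \<circ> x) (- t)) = (\<lambda>t. y (- t)) \<circ> \<tau>"
      using strict_mono_same_range range_decreasing_flow_line(1)[OF y G neg] by blast
    have "H \<circ> x = y \<circ> (\<lambda>t. - \<tau> (- t))"
    proof
      show "(H \<circ> x) t = (y \<circ> (\<lambda>t. - \<tau> (- t))) t" for t
        using fun_cong[OF \<tau>(3), of "- t"] by simp
    qed
    moreover have "strict_mono (\<lambda>t. - \<tau> (- t))"
      using \<tau>(1) by (simp add: strict_mono_def)
    moreover have "surj (\<lambda>t. - \<tau> (- t))"
      using range_reverse_time[of "\<lambda>t. - \<tau> t"] comp_surj[OF \<tau>(2) surj_uminus]
      by (simp add: comp_def)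
    ultimately show thesis
      using that by blast
  qed
qed

lemma image_oriented_orbits_subset:
  assumes f: "f \<in> C1_circle" and g: "g \<in> C1_circle" and H: "lift_of_circle_homeo H"
    and sgn: "\<And>x. sgn (g (to_circle (H x))) = sgn (f (to_circle x))"
  shows "(\<lambda>C. (\<lambda>\<gamma>. on_circle H \<circ> \<gamma>) ` C) ` oriented_orbits f \<subseteq> oriented_orbits g"
proof (rule image_subsetI)
  fix C assume "C \<in> oriented_orbits f"
  then obtain x where C: "C = oriented_curve (to_circle \<circ> x)" and x: "flow_line (f \<circ> to_circle) x"
    by (auto simp: oriented_orbits_def solution_iff_flow_line)
  obtain y where y: "flow_line (g \<circ> to_circle) y" "y 0 = H (x 0)"
    using C1_circle_flow_line_exists[OF g] .
  obtain L K where lip: "L-lipschitz_on UNIV (f \<circ> to_circle)" "K-lipschitz_on UNIV (g \<circ> to_circle)"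
    using C1_circle_lift_lipschitz f g by metis
  obtain \<tau> where \<tau>: "strict_mono \<tau>" "surj \<tau>" "H \<circ> x = y \<circ> \<tau>"
    by (rule flow_lines_conjugate[of H "g \<circ> to_circle" "f \<circ> to_circle", OF _ _ _ lip x y]) (use H sgn in \<open>auto simp: lift_of_circle_homeo_def\<close>)
  have "on_circle H \<circ> (to_circle \<circ> x) = to_circle \<circ> (H \<circ> x)"
    by (auto simp: on_circle_to_circle[OF H])
  also have "\<dots> = (to_circle \<circ> y) \<circ> \<tau>"
    by (simp add: \<tau>(3) comp_assoc)
  finally have "(\<lambda>\<gamma>. on_circle H \<circ> \<gamma>) ` C = oriented_curve (to_circle \<circ> y)"
    using \<tau>(1,2) by (simp add: C image_oriented_curve oriented_curve_reparametrised)
  then show "(\<lambda>\<gamma>. on_circle H \<circ> \<gamma>) ` C \<in> oriented_orbits g"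
    using y(1) by (auto simp: oriented_orbits_def solution_iff_flow_line)
qed

lemma image_orbits_inverse:
  fixes X :: "('a \<Rightarrow> 'b) set set"
  assumes "\<And>p. h (k p) = p"
  shows "(\<lambda>C. (\<lambda>\<gamma>. h \<circ> \<gamma>) ` C) ` (\<lambda>C. (\<lambda>\<gamma>. k \<circ> \<gamma>) ` C) ` X = X"
proof -
  have "h \<circ> (k \<circ> \<gamma>) = \<gamma>" for \<gamma> :: "'a \<Rightarrow> 'b"
    using assms by auto
  then show ?thesis by (simp add: image_image)
qed

text \<open>Orbits of \<open>f\<close> go to orbits of \<open>g\<close> under \<open>H\<close>; that all orbits of \<open>g\<close> are obtained follows by applying the
  same inclusion to the inverse of \<open>H\<close>, which also respects signs.\<close>

lemma topologically_equivalent_if_sgn_conjugate: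
  assumes f: "f \<in> C1_circle" and g: "g \<in> C1_circle" and H: "lift_of_circle_homeo H"
    and sgn: "\<And>x. sgn (g (to_circle (H x))) = sgn (f (to_circle x))"
  shows "topologically_equivalent f g"
proof -
  have "surj H" using H by (simp add: lift_of_circle_homeo_def)
  then have "sgn (f (to_circle (inv H x))) = sgn (g (to_circle x))" for x
    using sgn[of "inv H x"] by (simp add: surj_f_inv_f)
  then have "(\<lambda>C. (\<lambda>\<gamma>. on_circle (inv H) \<circ> \<gamma>) ` C) ` oriented_orbits g \<subseteq> oriented_orbits f"
    using image_oriented_orbits_subset[OF g f lift_inv[OF H]] by blast
  then have "oriented_orbits g \<subseteq> (\<lambda>C. (\<lambda>\<gamma>. on_circle H \<circ> \<gamma>) ` C) ` oriented_orbits f"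
    using image_orbits_inverse[of "on_circle H" "on_circle (inv H)" "oriented_orbits g",
        OF on_circle_inverse(1)[OF H]]
    by (metis image_mono)
  then have "(\<lambda>C. (\<lambda>\<gamma>. on_circle H \<circ> \<gamma>) ` C) ` oriented_orbits f = oriented_orbits g"
    using image_oriented_orbits_subset[OF f g H sgn] by blast
  then show ?thesis
    unfolding topologically_equivalent_def using homeomorphism_on_circle[OF H] by (intro exI conjI)
qed

section \<open>Topological equivalence is an equivalence relation\<close>

lemma topologically_equivalent_sym:
  assumes "topologically_equivalent f g"
  shows "topologically_equivalent g f"
proof -
  obtain h k where hk: "homeomorphism UNIV UNIV h k"
    and im: "(\<lambda>C. (\<lambda>\<gamma>. h \<circ> \<gamma>) ` C) ` oriented_orbits f = oriented_orbits g"
    using assms by (auto simp: topologically_equivalent_def)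
  have "k (h p) = p" for p using hk by (simp add: homeomorphism_def)
  then have "(\<lambda>C. (\<lambda>\<gamma>. k \<circ> \<gamma>) ` C) ` oriented_orbits g = oriented_orbits f"
    unfolding im[symmetric] by (rule image_orbits_inverse)
  then show ?thesis
    unfolding topologically_equivalent_def using homeomorphism_symD[OF hk] by (intro exI conjI)
qed

lemma topologically_equivalent_trans:
  assumes "topologically_equivalent f g" "topologically_equivalent g e"
  shows "topologically_equivalent f e"
proof -
  obtain h k h' k' where hk: "homeomorphism UNIV UNIV h k" "homeomorphism UNIV UNIV h' k'"
    and im: "(\<lambda>C. (\<lambda>\<gamma>. h \<circ> \<gamma>) ` C) ` oriented_orbits f = oriented_orbits g"
      "(\<lambda>C. (\<lambda>\<gamma>. h' \<circ> \<gamma>) ` C) ` oriented_orbits g = oriented_orbits e"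
    using assms by (auto simp: topologically_equivalent_def)
  have "(\<lambda>C. (\<lambda>\<gamma>. (h' \<circ> h) \<circ> \<gamma>) ` C) ` oriented_orbits f = oriented_orbits e"
    by (simp add: image_image comp_assoc flip: im)
  then show ?thesis
    unfolding topologically_equivalent_def using homeomorphism_compose[OF hk] by (intro exI conjI)
qed

section \<open>Periodic functions\<close>

lemma periodic_positive_lower_bound:
  fixes u :: "real \<Rightarrow> real"
  assumes u: "continuous_on UNIV u" "\<And>x y. x - y \<in> \<int> \<Longrightarrow> u x = u y"
    and S: "closed S" "\<And>x y. x - y \<in> \<int> \<Longrightarrow> x \<in> S \<Longrightarrow> y \<in> S"
    and pos: "\<And>x. x \<in> S \<Longrightarrow> u x > 0"
  obtains m where "m > 0" "\<And>x. x \<in> S \<Longrightarrow> m \<le> u x"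
proof (cases "S = {}")
  case True
  then show thesis using that[of 1] by simp
next
  case False
  have int: "x - frac x \<in> \<int>" for x :: real
    by (simp add: frac_def)
  have frac: "frac x \<in> {0..1} \<inter> S" if "x \<in> S" for x
    using that S(2)[OF int] by (simp add: frac_lt_1 less_imp_le)
  then have "{0..1} \<inter> S \<noteq> {}" using False by blast
  moreover have "compact ({0..1} \<inter> S)"
    using S(1) by (intro compact_Int_closed) auto
  ultimately obtain a where a: "a \<in> S" "\<And>x. x \<in> {0..1} \<inter> S \<Longrightarrow> u a \<le> u x"
    using continuous_attains_inf[of "{0..1} \<inter> S" u] continuous_on_subset[OF u(1)] by blast
  show thesis
  proof (rule that[of "u a"])
    show "u a \<le> u x" if "x \<in> S" for x
      using a(2)[OF frac[OF that]] u(2)[OF int] by simp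
  qed (use a pos in blast)
qed

lemma periodic_uniformly_continuous:
  fixes u :: "real \<Rightarrow> real"
  assumes u: "continuous_on UNIV u" "\<And>x y. x - y \<in> \<int> \<Longrightarrow> u x = u y" and e: "e > 0"
  obtains d where "d > 0" "\<And>x y. \<bar>x - y\<bar> < d \<Longrightarrow> \<bar>u x - u y\<bar> < e"
proof -
  have "uniformly_continuous_on {-1..2} u"
    by (intro compact_uniformly_continuous continuous_on_subset[OF u(1)]) auto
  then obtain d where d: "d > 0"
      "\<And>x y. x \<in> {-1..2} \<Longrightarrow> y \<in> {-1..2} \<Longrightarrow> \<bar>x - y\<bar> < d \<Longrightarrow> \<bar>u x - u y\<bar> < e"
    using e unfolding uniformly_continuous_on_def dist_real_def by (metis abs_minus_commute)
  show thesis
  proof (rule that[of "min d 1"])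
    fix x y :: real assume xy: "\<bar>x - y\<bar> < min d 1"
    define n where "n = real_of_int \<lfloor>x\<rfloor>"
    have n: "0 \<le> x - n" "x - n < 1" "n \<in> \<int>"
      by (simp_all add: n_def) linarith
    have "\<bar>u (x - n) - u (y - n)\<bar> < e"
      using xy n by (intro d(2)) auto
    moreover have "u (x - n) = u x" "u (y - n) = u y"
      using n by (auto intro!: u(2))
    ultimately show "\<bar>u x - u y\<bar> < e" by simp
  qed (use d in auto)
qed

section \<open>Moving the zeros of a vector field\<close>

text \<open>A displacement whose increments are smaller than those of its argument cannot reverse the order of
  two points; being bounded, it also leaves no gaps.\<close>

lemma lift_of_circle_homeo_add_displacement:
  assumes strict: "\<And>x y. x \<noteq> y \<Longrightarrow> \<bar>D x - D y\<bar> < \<bar>x - y\<bar>"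
    and bound: "\<And>x. \<bar>D x\<bar> \<le> \<delta>" and periodic: "\<And>x. D (x + 1) = D x"
  shows "lift_of_circle_homeo (\<lambda>x. x + D x)"
  unfolding lift_of_circle_homeo_def
proof (intro conjI allI)
  show "strict_mono (\<lambda>x. x + D x)"
  proof (rule strict_monoI)
    fix x y :: real assume "x < y"
    then show "x + D x < y + D y" using strict[of x y] by auto
  qed
  have "1-lipschitz_on UNIV D"
  proof (rule lipschitz_onI)
    show "dist (D x) (D y) \<le> 1 * dist x y" for x y
      using strict[of x y] by (cases "x = y") (auto simp: dist_real_def)
  qed simp
  then have "continuous_on UNIV D" by (rule lipschitz_on_continuous_on)
  then have cont: "continuous_on A (\<lambda>x. x + D x)" for A
    by (intro continuous_intros) (auto intro: continuous_on_subset)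
  show "surj (\<lambda>x. x + D x)"
  proof (intro surjI)
    fix y
    have "\<exists>x\<ge>y - \<delta>. x \<le> y + \<delta> \<and> x + D x = y"
    proof (rule IVT')
      show "y - \<delta> + D (y - \<delta>) \<le> y" "y \<le> y + \<delta> + D (y + \<delta>)"
        using bound[of "y - \<delta>"] bound[of "y + \<delta>"] by auto
      show "y - \<delta> \<le> y + \<delta>" using bound[of y] by auto
    qed (rule cont)
    then show "(SOME x. x + D x = y) + D (SOME x. x + D x = y) = y"
      by (metis (mono_tags, lifting) someI)
  qed
qed (simp add: periodic)

text \<open>Each point \<open>z\<close> of a separated periodic set is moved to a prescribed nearby point by adding to the
  identity a tent function of radius \<open>\<delta>\<close> centred at \<open>z\<close>. The tents have disjoint supports and slopes
  below \<open>1\<close> in absolute value, so the result is an increasing homeomorphism.\<close>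

lemma circle_homeo_moving_points:
  fixes w :: "real \<Rightarrow> real"
  assumes \<delta>: "\<delta> > 0"
    and sep: "\<And>z z'. z \<in> Z \<Longrightarrow> z' \<in> Z \<Longrightarrow> z \<noteq> z' \<Longrightarrow> 2 * \<delta> \<le> \<bar>z - z'\<bar>"
    and Z: "\<And>z. z + 1 \<in> Z \<longleftrightarrow> z \<in> Z"
    and w: "\<And>z. z \<in> Z \<Longrightarrow> \<bar>w z - z\<bar> < \<delta>" "\<And>z. z \<in> Z \<Longrightarrow> w (z + 1) = w z + 1"
  obtains H where "lift_of_circle_homeo H" "\<And>z. z \<in> Z \<Longrightarrow> H z = w z"
    "\<And>x. (\<And>z. z \<in> Z \<Longrightarrow> \<delta> \<le> \<bar>x - z\<bar>) \<Longrightarrow> H x = x"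
proof -
  define near where "near x z \<longleftrightarrow> z \<in> Z \<and> \<bar>x - z\<bar> < \<delta>" for x z
  define tent where "tent z x = (w z - z) * (1 - \<bar>x - z\<bar> / \<delta>)" for x z
  define D where "D x = (if \<exists>z. near x z then tent (SOME z. near x z) x else 0)" for x
  have "z = z'" if "near x z" "near x z'" for x z z'
    using that sep[of z z'] unfolding near_def by linarith
  then have D_near: "D x = tent z x" if "near x z" for x z
    using that unfolding D_def by (metis someI)
  have D_far: "D x = 0" if "\<not> (\<exists>z. near x z)" for x
    unfolding D_def using that by (rule if_not_P)
  \<comment> \<open>A tent is lower than the distance to the boundary of its support, so the values at two points
    with different tents add up to less than the distance of these points.\<close>
  have small: "\<bar>tent z x\<bar> < \<delta> - \<bar>x - z\<bar>" if "near x z" for x z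
  proof -
    have pos: "1 - \<bar>x - z\<bar> / \<delta> > 0" using that \<delta> by (simp add: near_def)
    have "\<bar>tent z x\<bar> = \<bar>w z - z\<bar> * (1 - \<bar>x - z\<bar> / \<delta>)"
      unfolding tent_def abs_mult using pos by simp
    also have "\<dots> < \<delta> * (1 - \<bar>x - z\<bar> / \<delta>)"
      using pos w(1)[of z] that by (intro mult_strict_right_mono) (auto simp: near_def)
    also have "\<dots> = \<delta> - \<bar>x - z\<bar>" using \<delta> by (simp add: field_simps)
    finally show ?thesis .
  qed
  have one_near: "\<bar>D x\<bar> < \<bar>x - y\<bar>" if "near x z" "\<not> (\<exists>z. near y z)" for x y z
    using small[OF that(1)] that D_near[OF that(1)] unfolding near_def by (smt (verit))
  have lip: "\<bar>D x - D y\<bar> < \<bar>x - y\<bar>" if "x \<noteq> y" for x y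
  proof (cases "(\<exists>z. near x z) \<and> (\<exists>z. near y z)")
    case True
    then obtain z z' where z: "near x z" "near y z'" by blast
    show ?thesis
    proof (cases "z = z'")
      case True
      have "tent z x - tent z y = (w z - z) / \<delta> * (\<bar>y - z\<bar> - \<bar>x - z\<bar>)"
        unfolding tent_def using \<delta> by (simp add: field_simps)
      then have "D x - D y = (w z - z) / \<delta> * (\<bar>y - z\<bar> - \<bar>x - z\<bar>)"
        using D_near[OF z(1)] D_near[OF z(2)] True by simp
      then have "\<bar>D x - D y\<bar> = \<bar>w z - z\<bar> / \<delta> * \<bar>\<bar>y - z\<bar> - \<bar>x - z\<bar>\<bar>"
        using \<delta> by (simp add: abs_mult)
      also have "\<dots> \<le> \<bar>w z - z\<bar> / \<delta> * \<bar>x - y\<bar>"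
        using \<delta> by (intro mult_left_mono) auto
      also have "\<dots> < 1 * \<bar>x - y\<bar>"
        using \<delta> w(1)[of z] z that by (intro mult_strict_right_mono) (auto simp: near_def)
      finally show ?thesis by simp
    next
      case False
      then have "2 * \<delta> \<le> \<bar>z - z'\<bar>" using z by (intro sep) (auto simp: near_def)
      then show ?thesis
        using small[OF z(1)] small[OF z(2)] D_near[OF z(1)] D_near[OF z(2)] by linarith
    qed
  next
    case False
    then consider z where "near x z" "\<not> (\<exists>z. near y z)"
      | z where "near y z" "\<not> (\<exists>z. near x z)"
      | "\<not> (\<exists>z. near x z)" "\<not> (\<exists>z. near y z)"
      by blast
    then show ?thesis
    proof cases
      case 1
      then show ?thesis using one_near[OF 1] D_far[OF 1(2)] by simp
    next
      case 2
      then show ?thesis using one_near[OF 2] D_far[OF 2(2)] by simp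
    next
      case 3
      then show ?thesis using D_far[OF 3(1)] D_far[OF 3(2)] that by simp
    qed
  qed
  have near_shift: "near (x + 1) (z + 1) \<longleftrightarrow> near x z" for x z
    by (simp add: near_def Z)
  show thesis
  proof (rule that[of "\<lambda>x. x + D x"])
    show "lift_of_circle_homeo (\<lambda>x. x + D x)"
    proof (rule lift_of_circle_homeo_add_displacement[OF lip])
      show "\<bar>D x\<bar> \<le> \<delta>" for x
      proof (cases "\<exists>z. near x z")
        case True
        then obtain z where "near x z" by blast
        then show ?thesis using small[of x z] D_near[of x z] by auto
      next
        case False
        then show ?thesis using D_far \<delta> by auto
      qed
      show "D (x + 1) = D x" for x
      proof (cases "\<exists>z. near x z")
        case True
        then obtain z where z: "near x z" by blast
        then have "tent (z + 1) (x + 1) = tent z x"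
          using w(2)[of z] by (simp add: tent_def near_def)
        then show ?thesis
          using z D_near near_shift by metis
      next
        case False
        then have "\<not> (\<exists>z. near (x + 1) z)"
          using near_shift by (metis diff_add_cancel)
        then show ?thesis using False by (simp add: D_far)
      qed
    qed simp
    show "z + D z = w z" if "z \<in> Z" for z
      using D_near[of z z] that \<delta> by (simp add: near_def tent_def)
    show "x + D x = x" if "\<And>z. z \<in> Z \<Longrightarrow> \<delta> \<le> \<bar>x - z\<bar>" for x
      using that D_far[of x] by (force simp: near_def)
  qed
qed

text \<open>The sign \<open>\<sigma>\<close> of the derivative is a parameter so that increasing and decreasing zeros are treated
  at once. The zero \<open>w\<close> may differ from the centre \<open>c\<close> of the interval: for a perturbed field the interval
  around the old zero contains the new one.\<close>

lemma sgn_near_simple_zero: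
  fixes \<phi> :: "real \<Rightarrow> real"
  assumes der: "\<And>x. (\<phi> has_real_derivative \<phi>' x) (at x)"
    and pos: "\<And>x. \<bar>x - c\<bar> \<le> r \<Longrightarrow> \<sigma> * \<phi>' x > 0" and \<sigma>: "\<bar>\<sigma>\<bar> = 1"
    and w: "\<phi> w = 0" "\<bar>w - c\<bar> \<le> r" and x: "\<bar>x - c\<bar> \<le> r"
  shows "sgn (\<phi> x) = \<sigma> * sgn (x - w)"
proof -
  have mono: "\<sigma> * \<phi> a < \<sigma> * \<phi> b" if "a < b" "\<bar>a - c\<bar> \<le> r" "\<bar>b - c\<bar> \<le> r" for a b
  proof (rule DERIV_pos_imp_increasing[OF that(1)])
    fix y assume "a \<le> y" "y \<le> b"
    then have "\<sigma> * \<phi>' y > 0" using that by (intro pos) auto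
    then show "\<exists>d. ((\<lambda>y. \<sigma> * \<phi> y) has_real_derivative d) (at y) \<and> 0 < d"
      using DERIV_cmult[OF der] by blast
  qed
  have \<sigma>': "\<sigma> = 1 \<or> \<sigma> = -1" using \<sigma> by auto
  consider "x < w" | "x = w" | "w < x" by linarith
  then show ?thesis
  proof cases
    case 1
    then show ?thesis using mono[OF 1 x w(2)] w(1) \<sigma>' by auto
  next
    case 2
    then show ?thesis using w by simp
  next
    case 3
    then show ?thesis using mono[OF 3 w(2) x] w(1) \<sigma>' by auto
  qed
qed

lemma sgn_eq_if_close: "\<bar>a - b\<bar> < m \<Longrightarrow> m \<le> \<bar>b\<bar> \<Longrightarrow> sgn a = sgn (b::real)"
  by (auto simp: sgn_if)

section \<open>Simple zeros persist\<close>

definition simple_zeros :: "(circle \<Rightarrow> real) \<Rightarrow> bool"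
  where "simple_zeros f \<longleftrightarrow> (\<forall>x. f (to_circle x) = 0 \<longrightarrow> deriv (f \<circ> to_circle) x \<noteq> 0)"

lemma C1_close:
  assumes f: "f \<in> C1_circle" and g: "g \<in> C1_circle" and e: "C1_norm (g - f) < e"
  shows "\<bar>g p - f p\<bar> < e" "\<bar>deriv (g \<circ> to_circle) x - deriv (f \<circ> to_circle) x\<bar> < e"
proof -
  have "((g - f) \<circ> to_circle) = (\<lambda>x. (g \<circ> to_circle) x - (f \<circ> to_circle) x)"
    by auto
  then have "deriv ((g - f) \<circ> to_circle) x = deriv (g \<circ> to_circle) x - deriv (f \<circ> to_circle) x"
    using DERIV_diff[OF C1_circle_has_derivative[OF g, of x] C1_circle_has_derivative[OF f, of x]]
    by (simp add: DERIV_imp_deriv)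
  then show "\<bar>g p - f p\<bar> < e" "\<bar>deriv (g \<circ> to_circle) x - deriv (f \<circ> to_circle) x\<bar> < e"
    using C1_norm_upper[OF C1_circle_diff[OF g f], of p x] e by auto
qed

text \<open>Around each zero of \<open>f\<close> there is an interval of a common radius \<open>\<delta>\<close> on which the derivative keeps its
  sign and is bounded away from \<open>0\<close>, and outside these intervals \<open>f\<close> itself is bounded away from \<open>0\<close>.
  A small perturbation in the \<open>C\<^sup>1\<close> norm keeps the sign of the derivative inside and the sign of the function
  outside, hence has exactly one zero in each interval and none elsewhere. Moving each old zero to
  the new one inside its interval matches the signs everywhere.\<close>

lemma simple_zeros_sgn_conjugate:
  assumes f: "f \<in> C1_circle" and simple: "simple_zeros f"
  obtains \<epsilon> where "\<epsilon> > 0"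
    "\<And>g. g \<in> C1_ball f \<epsilon> \<Longrightarrow> \<exists>H. lift_of_circle_homeo H \<and>
      (\<forall>x. sgn (g (to_circle (H x))) = sgn (f (to_circle x)))"
proof -
  define F where "F = f \<circ> to_circle"
  define F' where "F' = deriv F"
  have derF: "(F has_real_derivative F' x) (at x)" for x
    using C1_circle_has_derivative[OF f] by (simp add: F_def F'_def)
  have contF: "continuous_on UNIV F" "continuous_on UNIV F'"
    using C1_circle_continuous[OF f] f by (simp_all add: F_def F'_def C1_circle_iff)
  have perF: "F x = F y" "F' x = F' y" if "x - y \<in> \<int>" for x y
    using that deriv_to_circle_periodic[OF f that] to_circle_eq_iff[of x y]
    by (simp_all add: F_def F'_def)
  have simpleF: "F' x \<noteq> 0" if "F x = 0" for x
    using simple that by (simp add: simple_zeros_def F_def F'_def)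
  obtain m where m: "m > 0" "\<And>x. m \<le> \<bar>F x\<bar> + \<bar>F' x\<bar>"
  proof (rule periodic_positive_lower_bound[of "\<lambda>x. \<bar>F x\<bar> + \<bar>F' x\<bar>" UNIV])
    show "continuous_on UNIV (\<lambda>x. \<bar>F x\<bar> + \<bar>F' x\<bar>)"
      by (intro continuous_intros contF)
    show "\<bar>F x\<bar> + \<bar>F' x\<bar> = \<bar>F y\<bar> + \<bar>F' y\<bar>" if "x - y \<in> \<int>" for x y
      using perF[OF that] by simp
    show "0 < \<bar>F x\<bar> + \<bar>F' x\<bar>" for x
      using simpleF[of x] by (cases "F x = 0") auto
  qed auto
  obtain d where d: "d > 0" "\<And>x y. \<bar>x - y\<bar> < d \<Longrightarrow> \<bar>F' x - F' y\<bar> < m / 2"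
    using periodic_uniformly_continuous[OF contF(2) perF(2), of "m / 2"] m(1) by auto
  \<comment> \<open>The derivative is controlled up to distance \<open>2 \<delta>\<close> from a zero, which keeps the
    intervals of radius \<open>\<delta>\<close> around different zeros disjoint.\<close>
  define \<delta> where "\<delta> = d / 3"
  have \<delta>: "\<delta> > 0" "2 * \<delta> < d" using d by (simp_all add: \<delta>_def)
  define Z where "Z = {z. F z = 0}"
  define \<sigma> where "\<sigma> z = sgn (F' z)" for z
  have \<sigma>: "\<bar>\<sigma> z\<bar> = 1" if "z \<in> Z" for z
    using that simpleF by (simp add: Z_def \<sigma>_def abs_sgn_eq)
  have slope: "\<sigma> z * t > 0" if "z \<in> Z" "\<bar>t - F' z\<bar> < m" for z t
    using that m(2)[of z] by (auto simp: Z_def \<sigma>_def sgn_if)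
  have F'_near: "\<bar>F' x - F' z\<bar> < m / 2" if "\<bar>x - z\<bar> \<le> 2 * \<delta>" for x z
    using that \<delta> by (intro d(2)) auto
  have sgnF: "sgn (F x) = \<sigma> z * sgn (x - z)" if "z \<in> Z" "\<bar>x - z\<bar> \<le> 2 * \<delta>" for x z
  proof (rule sgn_near_simple_zero[OF derF _ \<sigma>[OF that(1)]])
    show "\<sigma> z * F' x > 0" if "\<bar>x - z\<bar> \<le> 2 * \<delta>" for x
      using F'_near[OF that] m(1) by (intro slope \<open>z \<in> Z\<close>) auto
  qed (use that \<delta> in \<open>auto simp: Z_def\<close>)
  have sep: "2 * \<delta> \<le> \<bar>z - z'\<bar>" if "z \<in> Z" "z' \<in> Z" "z \<noteq> z'" for z z'
  proof (rule ccontr)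
    assume "\<not> 2 * \<delta> \<le> \<bar>z - z'\<bar>"
    then have "sgn (F z') = \<sigma> z * sgn (z' - z)"
      using that by (intro sgnF) auto
    then show False
      using that \<sigma>[of z] by (auto simp: Z_def sgn_eq_0_iff)
  qed
  \<comment> \<open>\<open>S\<close> is the complement of the \<open>\<delta>\<close>-neighbourhood of the zeros. It contains the end points of
    the intervals, so that the signs of a perturbed field are known there.\<close>
  define S where "S = {x. \<forall>z\<in>Z. \<delta> \<le> \<bar>x - z\<bar>}"
  have perZ: "z \<in> Z \<longleftrightarrow> z' \<in> Z" if "z - z' \<in> \<int>" for z z'
    using perF(1)[OF that] by (simp add: Z_def)
  obtain \<mu> where \<mu>: "\<mu> > 0" "\<And>x. x \<in> S \<Longrightarrow> \<mu> \<le> \<bar>F x\<bar>"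
  proof (rule periodic_positive_lower_bound[of "\<lambda>x. \<bar>F x\<bar>" S])
    show "continuous_on UNIV (\<lambda>x. \<bar>F x\<bar>)"
      by (intro continuous_intros contF)
    show "\<bar>F x\<bar> = \<bar>F y\<bar>" if "x - y \<in> \<int>" for x y
      using perF[OF that] by simp
    have "closed {x. \<delta> \<le> \<bar>x - z\<bar>}" for z :: real
      by (intro closed_Collect_le continuous_intros)
    then have "closed (\<Inter>z\<in>Z. {x. \<delta> \<le> \<bar>x - z\<bar>})" by auto
    moreover have "S = (\<Inter>z\<in>Z. {x. \<delta> \<le> \<bar>x - z\<bar>})" by (auto simp: S_def)
    ultimately show "closed S" by simp
    show "y \<in> S" if "x - y \<in> \<int>" "x \<in> S" for x y
      unfolding S_def
    proof safe
      fix z assume "z \<in> Z"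
      then have "z + (x - y) \<in> Z" using perZ[of "z + (x - y)" z] that by simp
      then have "\<delta> \<le> \<bar>x - (z + (x - y))\<bar>" using \<open>x \<in> S\<close> unfolding S_def by blast
      then show "\<delta> \<le> \<bar>y - z\<bar>" by simp
    qed
    show "\<bar>F x\<bar> > 0" if "x \<in> S" for x
      using that \<delta> by (force simp: S_def Z_def)
  qed (rule that)
  have ends: "z - \<delta> \<in> S" "z + \<delta> \<in> S" if "z \<in> Z" for z
  proof -
    have "\<delta> \<le> \<bar>z - \<delta> - z'\<bar> \<and> \<delta> \<le> \<bar>z + \<delta> - z'\<bar>" if "z' \<in> Z" for z'
      using sep[OF \<open>z \<in> Z\<close> that] \<delta> by (cases "z = z'") auto
    then show "z - \<delta> \<in> S" "z + \<delta> \<in> S" by (auto simp: S_def)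
  qed
  show thesis
  proof (rule that[of "min (m / 2) \<mu>"])
    show "min (m / 2) \<mu> > 0" using m \<mu> by simp
    fix g assume "g \<in> C1_ball f (min (m / 2) \<mu>)"
    then have g: "g \<in> C1_circle" "C1_norm (g - f) < min (m / 2) \<mu>"
      by (auto simp: C1_ball_def)
    define G where "G = g \<circ> to_circle"
    define G' where "G' = deriv G"
    have derG: "(G has_real_derivative G' x) (at x)" for x
      using C1_circle_has_derivative[OF g(1)] by (simp add: G_def G'_def)
    have close: "\<bar>G x - F x\<bar> < \<mu>" "\<bar>G' x - F' x\<bar> < m / 2" for x
      using C1_close(1)[OF f g, of "to_circle x"] C1_close(2)[OF f g, of x] by (simp_all add: G_def F_def G'_def F'_def)
    have sgn_far: "sgn (G x) = sgn (F x)" if "x \<in> S" for x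
      using close(1) \<mu>(2)[OF that] by (rule sgn_eq_if_close)
    have sgnG: "sgn (G x) = \<sigma> z * sgn (x - w)"
      if "z \<in> Z" "G w = 0" "\<bar>w - z\<bar> \<le> \<delta>" "\<bar>x - z\<bar> \<le> \<delta>" for x w z
    proof (rule sgn_near_simple_zero[OF derG _ \<sigma>[OF that(1)] that(2-4)])
      fix x assume "\<bar>x - z\<bar> \<le> \<delta>"
      then have "\<bar>G' x - F' z\<bar> < m"
        using close(2)[of x] F'_near[of x z] \<delta> by linarith
      then show "\<sigma> z * G' x > 0" using that by (intro slope) auto
    qed
    have "\<exists>w. \<bar>w - z\<bar> < \<delta> \<and> G w = 0" if z: "z \<in> Z" for z
    proof -
      have "sgn (G (z - \<delta>)) = - \<sigma> z" "sgn (G (z + \<delta>)) = \<sigma> z"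
        using sgn_far[OF ends(1)[OF z]] sgn_far[OF ends(2)[OF z]] sgnF[OF z] \<delta> by auto
      then have signs: "\<sigma> z * G (z - \<delta>) < 0" "\<sigma> z * G (z + \<delta>) > 0"
        using \<sigma>[OF z] by (auto simp: sgn_if abs_if split: if_splits)
      have "continuous_on {z - \<delta>..z + \<delta>} (\<lambda>x. \<sigma> z * G x)"
        using DERIV_isCont[OF derG] by (intro continuous_intros) (simp add: continuous_at_imp_continuous_on)
      then obtain w where w: "z - \<delta> \<le> w" "w \<le> z + \<delta>" "\<sigma> z * G w = 0"
        using IVT'[of "\<lambda>x. \<sigma> z * G x" "z - \<delta>" 0 "z + \<delta>"] signs \<delta> by auto
      then have "w \<noteq> z - \<delta>" "w \<noteq> z + \<delta>" "G w = 0"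
        using signs \<sigma>[OF z] by auto
      then show ?thesis using w by (intro exI[of _ w]) auto
    qed
    then obtain w where w: "\<And>z. z \<in> Z \<Longrightarrow> \<bar>w z - z\<bar> < \<delta> \<and> G (w z) = 0"
      by metis
    have perZ1: "z + 1 \<in> Z \<longleftrightarrow> z \<in> Z" for z
      by (rule perZ) simp
    have w_unique: "w z = v" if "z \<in> Z" "\<bar>v - z\<bar> < \<delta>" "G v = 0" for z v
    proof -
      have "sgn (G v) = \<sigma> z * sgn (v - w z)"
        using w[OF that(1)] that by (intro sgnG) auto
      then show ?thesis using that \<sigma>[of z] by (auto simp: sgn_eq_0_iff)
    qed
    have w_shift: "w (z + 1) = w z + 1" if "z \<in> Z" for z
    proof (rule w_unique)
      show "z + 1 \<in> Z" using that perZ1 by simp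
      show "\<bar>w z + 1 - (z + 1)\<bar> < \<delta>" "G (w z + 1) = 0"
        using w[OF that] by (simp_all add: G_def)
    qed
    obtain H where H: "lift_of_circle_homeo H" "\<And>z. z \<in> Z \<Longrightarrow> H z = w z"
        "\<And>x. (\<And>z. z \<in> Z \<Longrightarrow> \<delta> \<le> \<bar>x - z\<bar>) \<Longrightarrow> H x = x"
      by (rule circle_homeo_moving_points[of \<delta> Z w, OF \<delta>(1) sep perZ1 _ w_shift]) (use w in auto)
    have mono: "strict_mono H" using H(1) by (simp add: lift_of_circle_homeo_def)
    have H_far: "H x = x" if "x \<in> S" for x
      using that by (intro H(3)) (auto simp: S_def)
    have "sgn (G (H x)) = sgn (F x)" for x
    proof (cases "x \<in> S")
      case True
      then show ?thesis using H_far sgn_far by simp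
    next
      case False
      then obtain z where z: "z \<in> Z" "\<bar>x - z\<bar> < \<delta>" by (auto simp: S_def)
      have "H (z - \<delta>) < H x" "H x < H (z + \<delta>)"
        using z by (auto intro!: strict_monoD[OF mono])
      then have "\<bar>H x - z\<bar> \<le> \<delta>"
        using H_far[OF ends(1)[OF z(1)]] H_far[OF ends(2)[OF z(1)]] by auto
      then have "sgn (G (H x)) = \<sigma> z * sgn (H x - H z)"
        using w[OF z(1)] H(2)[OF z(1)] z(1) by (intro sgnG) auto
      also have "sgn (H x - H z) = sgn (x - z)"
        using strict_mono_less[OF mono, of x z] strict_mono_less[OF mono, of z x]
        by (auto simp: sgn_if)
      also have "\<sigma> z * sgn (x - z) = sgn (F x)"
        using sgnF[OF z(1), of x] z(2) \<delta> by simp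
      finally show ?thesis .
    qed
    then show "\<exists>H. lift_of_circle_homeo H \<and> (\<forall>x. sgn (g (to_circle (H x))) = sgn (f (to_circle x)))"
      using H(1) by (auto simp: G_def F_def)
  qed
qed

section \<open>The structurally stable vector fields\<close>

text \<open>All fields in a ball around \<open>f\<close> on which the equivalence class is constant are equivalent to each
  other, and each of them has a smaller ball inside that one.\<close>

lemma openin_SS1: "openin C1_topology SS1"
  unfolding openin_C1_topology
proof (intro conjI ballI)
  show "SS1 \<subseteq> C1_circle" by (auto simp: SS1_def)
  fix f assume f: "f \<in> SS1"
  then have "f \<in> C1_circle" by (simp add: SS1_def)
  have "\<forall>\<^sub>F \<epsilon> in at_right 0. \<epsilon> > 0 \<and> (\<forall>g \<in> C1_ball f \<epsilon>. topologically_equivalent g f)"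
    using f by (intro eventually_conj eventually_at_right_less) (simp add: SS1_def structurally_stable_def)
  then obtain \<epsilon> where \<epsilon>: "\<epsilon> > 0" "\<And>g. g \<in> C1_ball f \<epsilon> \<Longrightarrow> topologically_equivalent g f"
    using eventually_happens'[OF trivial_limit_at_right_real] by blast
  have "C1_ball f \<epsilon> \<subseteq> SS1"
  proof
    fix g assume g: "g \<in> C1_ball f \<epsilon>"
    then have gC: "g \<in> C1_circle" by (simp add: C1_ball_def)
    define r where "r = \<epsilon> - C1_norm (g - f)"
    have r: "r > 0" using g by (simp add: r_def C1_ball_def)
    have "topologically_equivalent e g" if "s < r" "e \<in> C1_ball g s" for s e
    proof -
      have "e \<in> C1_ball f \<epsilon>"
        using that C1_norm_diff_triangle[OF \<open>f \<in> C1_circle\<close> gC, of e] by (auto simp: C1_ball_def r_def)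
      then show ?thesis
        using \<epsilon>(2) g topologically_equivalent_sym topologically_equivalent_trans by blast
    qed
    then have "structurally_stable g"
      unfolding structurally_stable_def using r by (auto simp: eventually_at_right[of 0 1])
    then show "g \<in> SS1" using gC by (simp add: SS1_def)
  qed
  then show "\<exists>\<epsilon>>0. C1_ball f \<epsilon> \<subseteq> SS1" using \<epsilon>(1) by blast
qed

lemma simple_zeros_structurally_stable:
  assumes f: "f \<in> C1_circle" and "simple_zeros f"
  shows "structurally_stable f"
proof -
  obtain \<epsilon> where \<epsilon>: "\<epsilon> > 0" and conj: "\<And>g. g \<in> C1_ball f \<epsilon> \<Longrightarrow> \<exists>H. lift_of_circle_homeo H \<and>
      (\<forall>x. sgn (g (to_circle (H x))) = sgn (f (to_circle x)))"
    using simple_zeros_sgn_conjugate[OF assms] by metis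
  have "topologically_equivalent g f" if "s < \<epsilon>" "g \<in> C1_ball f s" for s g
  proof -
    have g: "g \<in> C1_ball f \<epsilon>" "g \<in> C1_circle" using that by (auto simp: C1_ball_def)
    then have "topologically_equivalent f g"
      using conj[OF g(1)] topologically_equivalent_if_sgn_conjugate[OF f] by blast
    then show ?thesis by (rule topologically_equivalent_sym)
  qed
  then show ?thesis
    unfolding structurally_stable_def using \<epsilon> by (auto simp: eventually_at_right[of 0 1])
qed

text \<open>The one-dimensional case of Sard's theorem, in the one-dimensional Cartesian space.\<close>

lemma negligible_critical_values:
  fixes F :: "real \<Rightarrow> real"
  assumes der: "\<And>x. (F has_real_derivative F' x) (at x)"
  shows "negligible ((\<lambda>x. vec (F x)) ` {x. F' x = 0} :: (real^1) set)"
proof -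
  have "((\<lambda>v::real^1. vec (F (v $ 1)) :: real^1) has_derivative
      (\<lambda>h. vec (F' (v $ 1) * h $ 1))) (at v within {v. F' (v $ 1) = 0})" for v :: "real^1"
  proof -
    have "((\<lambda>v::real^1. F (v $ 1)) has_derivative (\<lambda>h. F' (v $ 1) * h $ 1)) (at v)"
      using has_derivative_compose[OF bounded_linear_imp_has_derivative[OF bounded_linear_vec_nth], of F "(*) (F' (v $ 1))" v]
        der[of "v $ 1"] by (simp add: has_field_derivative_def)
    then show ?thesis
      by (rule bounded_linear.has_derivative[OF
            linear_conv_bounded_linear[THEN iffD1, OF linear_vec] has_derivative_at_withinI])
  qed
  then have "negligible ((\<lambda>v::real^1. vec (F (v $ 1)) :: real^1) ` {v. F' (v $ 1) = 0})"
    by (rule baby_Sard[where f' = "\<lambda>v h. vec (F' (v $ 1) * h $ 1)", rotated])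
      (auto simp: rank_eq_0 matrix_def vec_eq_iff)
  moreover have "(\<lambda>x. vec (F x)) ` {x. F' x = 0} \<subseteq>
      (\<lambda>v::real^1. vec (F (v $ 1)) :: real^1) ` {v. F' (v $ 1) = 0}"
  proof (rule image_subsetI)
    fix x assume "x \<in> {x. F' x = 0}"
    then show "vec (F x) \<in> (\<lambda>v::real^1. vec (F (v $ 1)) :: real^1) ` {v. F' (v $ 1) = 0}"
      by (intro image_eqI[of _ _ "vec x"]) simp_all
  qed
  ultimately show ?thesis by (rule negligible_subset)
qed

lemma regular_value_below:
  fixes F :: "real \<Rightarrow> real"
  assumes der: "\<And>x. (F has_real_derivative F' x) (at x)" and "\<epsilon> > 0"
  obtains c where "0 < c" "c < \<epsilon>" "\<And>x. F x = c \<Longrightarrow> F' x \<noteq> 0"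
proof -
  have "open {v::real^1. 0 < v $ 1 \<and> v $ 1 < \<epsilon>}"
    by (intro open_Collect_conj open_Collect_less continuous_intros)
  moreover have "(vec (\<epsilon> / 2) :: real^1) \<in> {v::real^1. 0 < v $ 1 \<and> v $ 1 < \<epsilon>}"
    using \<open>\<epsilon> > 0\<close> by simp
  ultimately have "\<not> negligible {v::real^1. 0 < v $ 1 \<and> v $ 1 < \<epsilon>}"
    using open_not_negligible by blast
  then have "\<not> {v::real^1. 0 < v $ 1 \<and> v $ 1 < \<epsilon>} \<subseteq> (\<lambda>x. vec (F x)) ` {x. F' x = 0}"
    using negligible_subset[OF negligible_critical_values[of F F', OF der]] by metis
  then obtain v :: "real^1" where v: "0 < v $ 1" "v $ 1 < \<epsilon>" "v \<notin> (\<lambda>x. vec (F x)) ` {x. F' x = 0}"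
    by (auto simp: subset_iff)
  show thesis
  proof (rule that[OF v(1,2)])
    fix x assume "F x = v $ 1"
    then have "v = vec (F x)" by (simp add: vec_eq_iff)
    then show "F' x \<noteq> 0" using v(3) by blast
  qed
qed

text \<open>The zeros of \<open>f - c\<close> are the points where \<open>f\<close> has the value \<open>c\<close>; they are simple for a
  regular value \<open>c\<close>, and \<open>c\<close> is the \<open>C\<^sup>1\<close> distance from \<open>f - c\<close> to \<open>f\<close>.\<close>

lemma simple_zeros_dense:
  assumes f: "f \<in> C1_circle" and "\<epsilon> > 0"
  obtains g where "g \<in> C1_ball f \<epsilon>" "simple_zeros g"
proof -
  obtain c where c: "0 < c" "c < \<epsilon>"
      "\<And>x. (f \<circ> to_circle) x = c \<Longrightarrow> deriv (f \<circ> to_circle) x \<noteq> 0"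
    using regular_value_below[OF C1_circle_has_derivative[OF f] \<open>\<epsilon> > 0\<close>] by blast
  define k where "k = (\<lambda>p::circle. c)"
  have k: "k \<in> C1_circle" by (simp add: C1_circle_def k_def comp_def)
  have der: "deriv ((f - k) \<circ> to_circle) x = deriv (f \<circ> to_circle) x" for x
  proof (rule DERIV_imp_deriv)
    show "((f - k) \<circ> to_circle has_real_derivative deriv (f \<circ> to_circle) x) (at x)"
      using DERIV_diff[OF C1_circle_has_derivative[OF f, of x] DERIV_const[of c]]
      by (simp add: k_def comp_def)
  qed
  show thesis
  proof (rule that[of "f - k"])
    have "(f - k) - f = (\<lambda>p. - c)" by (auto simp: k_def)
    then have "C1_norm ((f - k) - f) = c"
      using c by (simp add: C1_norm_def comp_def)
    then show "f - k \<in> C1_ball f \<epsilon>"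
      using C1_circle_diff[OF f k] c by (simp add: C1_ball_def)
    show "simple_zeros (f - k)"
      using c(3) by (simp add: simple_zeros_def der) (simp add: k_def)
  qed
qed

theorem theorem2:
  shows "openin C1_topology SS1 \<and> C1_topology closure_of SS1 = C1_circle"
proof
  show "openin C1_topology SS1" by (rule openin_SS1)
  show "C1_topology closure_of SS1 = C1_circle"
  proof
    show "C1_topology closure_of SS1 \<subseteq> C1_circle"
      using closure_of_subset_topspace[of C1_topology SS1] by (simp add: topspace_C1_topology)
    show "C1_circle \<subseteq> C1_topology closure_of SS1"
    proof
      fix f assume f: "f \<in> C1_circle"
      have "\<exists>g\<in>SS1. g \<in> U" if "f \<in> U" "openin C1_topology U" for U
      proof -
        obtain \<epsilon> where "\<epsilon> > 0" "C1_ball f \<epsilon> \<subseteq> U"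
          using \<open>f \<in> U\<close> \<open>openin C1_topology U\<close> openin_C1_topology by blast
        moreover obtain g where "g \<in> C1_ball f \<epsilon>" "simple_zeros g"
          using simple_zeros_dense[OF f \<open>\<epsilon> > 0\<close>] .
        moreover from this have "g \<in> SS1"
          by (simp add: SS1_def C1_ball_def simple_zeros_structurally_stable)
        ultimately show ?thesis by blast
      qed
      then show "f \<in> C1_topology closure_of SS1"
        using f by (auto simp: in_closure_of topspace_C1_topology)
    qed
  qed
qed

end
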